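(* Let $S=\{1,\dots,N\}$, let $E,A(i),C(i)\in\mathbb{R}^{n\times n}$ ($i\in S$) with $\operatorname{rank}(E)=r\le n$, and consider the discrete-time singular stochastic Markov jump system $$Ex(k+1)=A(r_k)x(k)+C(r_k)x(k)w(k),\qquad x(0)=x_0\in\mathbb{R}^n,$$ where $w(k)\in\mathbb{R}$ is a wide stationary second-order process with $\mathbb{E}(w(k))=0$, $\mathbb{E}(w(k)w(s))=\delta_{ks}$, and $(r_k)$ is a Markov chain on $S$ with transition probability matrix $\Lambda=(\lambda_{ij})_{N\times N}$. Assume $\operatorname{rank}[E\ \ C(i)]=\operatorname{rank}(E)$ for every $i\in S$. Let $F$ be a real matrix with $n$ rows and full column rank satisfying $E^TF=0$. If there exist positive definite matrices $P(i)>0$, $i\in S$, and a symmetric nonsingular matrix $Q$ (of size compatible with $F$) such that for each $i\in S$ $$A^T(i)\Big(\sum_{j=1}^N\lambda_{ij}P(j)+FQF^T\Big)A(i)+C^T(i)\Big(\sum_{j=1}^N\lambda_{ij}P(j)+FQF^T\Big)C(i)-E^TP(i)E<0,$$ then the system is mean square admissible.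
   Context: $\lambda_{ij}=\Pr\{r_{k+1}=j\mid r_k=i\}\ge0$, $\sum_{j=1}^N\lambda_{ij}=1$; $\delta_{ks}$ is the Kronecker delta; $R(\cdot)$ is the rank, $\mathbb{E}$ the expectation; $X>0$ ($X<0$) means real symmetric positive (negative) definite. Causal: for every $i\in S$ there are nonsingular $M(i),N(i)\in\mathbb{R}^{n\times n}$ such that either (a) $M(i)EN(i)=\begin{bmatrix}I_{n_1}&0\\0&N_{n_2}(i)\end{bmatrix}$, $M(i)A(i)N(i)=\begin{bmatrix}\tilde A_{11}(i)&0\\0&I_{n_2}\end{bmatrix}$, $M(i)C(i)N(i)=\begin{bmatrix}\tilde C_{11}(i)&\tilde C_{12}(i)\\0&0\end{bmatrix}$ with $N_{n_2}(i)\in\mathbb{R}^{n_2\times n_2}$ nilpotent, $\tilde A_{11}(i),\tilde C_{11}(i)\in\mathbb{R}^{n_1\times n_1}$, $n_1+n_2=n$, and moreover $\deg(\det(sE-A(i)))=R(E)$; or (b) $M(i)EN(i)=\begin{bmatrix}I_r&0\\0&0\end{bmatrix}$, $M(i)A(i)N(i)=\begin{bmatrix}\bar A_{11}(i)&0\\0&I_{n-r}\end{bmatrix}$, $M(i)C(i)N(i)=\begin{bmatrix}\bar C_{11}(i)&\bar C_{12}(i)\\0&\bar C_{22}(i)\end{bmatrix}$ with $\bar A_{11}(i),\bar C_{11}(i)\in\mathbb{R}^{r\times r}$. Asymptotically stable in the mean square: the system has a unique solution and $\lim_{k\to\infty}\mathbb{E}\{\|x(k)\|^2\mid x_0,r_0\}=0$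 for any initial condition $x_0\in\mathbb{R}^n$. Mean square admissible: the system has a unique solution, is causal, and is asymptotically stable in the mean square.
   Formalization: Added: given r_0..r_k, w(0)..w(k-1), w(k) has mean 0 and variance 1; given also w(k), r_{k+1} has law λ_{r_k,·} (uncorrelated w alone does not suffice). x(0)=x_0 is imposed only where x_0 is consistent with the equation at k=0, otherwise Ex(0)=Ex_0. *)

theory Defs
  imports
    "HOL-Probability.Probability"
    "Jordan_Normal_Form.DL_Rank"
begin

unbundle no inner_syntax and no vec_syntax

text \<open>
  Matrices and vectors are those of \<open>Jordan_Normal_Form\<close>, so that block sizes (in particular
  the number of columns of \<open>F\<close>, which is \<open>0\<close> when \<open>E\<close> is nonsingular) are ordinary numbers.
  The mode set is \<open>{1..N}\<close>, and \<open>A i\<close>, \<open>C i\<close>, \<open>P i\<close> are only meaningful for \<open>i\<close> in that set.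
\<close>

definition pos_def_mat :: "nat \<Rightarrow> real mat \<Rightarrow> bool" where
  "pos_def_mat n X \<longleftrightarrow> X \<in> carrier_mat n n \<and> transpose_mat X = X \<and>
     (\<forall>v \<in> carrier_vec n. v \<noteq> 0\<^sub>v n \<longrightarrow> 0 < v \<bullet> (X *\<^sub>v v))"

definition neg_def_mat :: "nat \<Rightarrow> real mat \<Rightarrow> bool" where
  "neg_def_mat n X \<longleftrightarrow> X \<in> carrier_mat n n \<and> transpose_mat X = X \<and>
     (\<forall>v \<in> carrier_vec n. v \<noteq> 0\<^sub>v n \<longrightarrow> v \<bullet> (X *\<^sub>v v) < 0)"

text \<open>\<open>\<Sum>\<^sub>j lam\<^sub>i\<^sub>j P(j)\<close>, written entrywise because matrices of unspecified size have no zero.\<close>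

definition mode_average ::
  "nat \<Rightarrow> nat \<Rightarrow> (nat \<Rightarrow> nat \<Rightarrow> real) \<Rightarrow> (nat \<Rightarrow> real mat) \<Rightarrow> nat \<Rightarrow> real mat" where
  "mode_average n N lam P i = mat n n (\<lambda>(a, b). \<Sum>j=1..N. lam i j * P j $$ (a, b))"

definition nonsingular_mat :: "nat \<Rightarrow> real mat \<Rightarrow> bool" where
  "nonsingular_mat n X \<longleftrightarrow> X \<in> carrier_mat n n \<and> invertible_mat X"

definition nilpotent_mat :: "nat \<Rightarrow> real mat \<Rightarrow> bool" where
  "nilpotent_mat n X \<longleftrightarrow> X \<in> carrier_mat n n \<and> (\<exists>k. X ^\<^sub>m k = 0\<^sub>m n n)"

definition pencil_det :: "real mat \<Rightarrow> real mat \<Rightarrow> real poly" where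
  "pencil_det E A = det (map_mat (\<lambda>e. [:0, e:]) E - map_mat (\<lambda>a. [:a:]) A)"

definition causal_a :: "nat \<Rightarrow> real mat \<Rightarrow> real mat \<Rightarrow> real mat \<Rightarrow> bool" where
  "causal_a n E A C \<longleftrightarrow>
     (\<exists>L R n1 n2 N2 A11 C11 C12.
        nonsingular_mat n L \<and> nonsingular_mat n R \<and> n1 + n2 = n \<and>
        nilpotent_mat n2 N2 \<and> A11 \<in> carrier_mat n1 n1 \<and>
        C11 \<in> carrier_mat n1 n1 \<and> C12 \<in> carrier_mat n1 n2 \<and>
        L * E * R = four_block_mat (1\<^sub>m n1) (0\<^sub>m n1 n2) (0\<^sub>m n2 n1) N2 \<and>
        L * A * R = four_block_mat A11 (0\<^sub>m n1 n2) (0\<^sub>m n2 n1) (1\<^sub>m n2) \<and>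
        L * C * R = four_block_mat C11 C12 (0\<^sub>m n2 n1) (0\<^sub>m n2 n2)) \<and>
     degree (pencil_det E A) = vec_space.rank n E"

definition causal_b :: "nat \<Rightarrow> real mat \<Rightarrow> real mat \<Rightarrow> real mat \<Rightarrow> bool" where
  "causal_b n E A C \<longleftrightarrow>
     (let \<rho> = vec_space.rank n E in
      \<exists>L R A11 C11 C12 C22.
        nonsingular_mat n L \<and> nonsingular_mat n R \<and>
        A11 \<in> carrier_mat \<rho> \<rho> \<and> C11 \<in> carrier_mat \<rho> \<rho> \<and>
        C12 \<in> carrier_mat \<rho> (n - \<rho>) \<and> C22 \<in> carrier_mat (n - \<rho>) (n - \<rho>) \<and>
        L * E * R =
          four_block_mat (1\<^sub>m \<rho>) (0\<^sub>m \<rho> (n - \<rho>)) (0\<^sub>m (n - \<rho>) \<rho>) (0\<^sub>m (n - \<rho>) (n - \<rho>)) \<and>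
        L * A * R =
          four_block_mat A11 (0\<^sub>m \<rho> (n - \<rho>)) (0\<^sub>m (n - \<rho>) \<rho>) (1\<^sub>m (n - \<rho>)) \<and>
        L * C * R = four_block_mat C11 C12 (0\<^sub>m (n - \<rho>) \<rho>) C22)"

definition causal ::
  "nat \<Rightarrow> nat \<Rightarrow> real mat \<Rightarrow> (nat \<Rightarrow> real mat) \<Rightarrow> (nat \<Rightarrow> real mat) \<Rightarrow> bool" where
  "causal n N E A C \<longleftrightarrow> (\<forall>i \<in> {1..N}. causal_a n E (A i) (C i) \<or> causal_b n E (A i) (C i))"

text \<open>
  The \<open>\<sigma>\<close>-algebra generated by \<open>r\<^sub>0, \<dots>, r\<^sub>k\<close> and \<open>w\<^sub>0, \<dots>, w\<^sub>l\<^sub>-\<^sub>1\<close>. The state \<open>x k\<close> is determined by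
  \<open>history M r w k k\<close>, and \<open>history M r w 0 0\<close> is generated by \<open>r\<^sub>0\<close> alone.
\<close>

definition history ::
  "'a measure \<Rightarrow> (nat \<Rightarrow> 'a \<Rightarrow> nat) \<Rightarrow> (nat \<Rightarrow> 'a \<Rightarrow> real) \<Rightarrow> nat \<Rightarrow> nat \<Rightarrow> 'a measure" where
  "history M r w k l =
     sigma (space M)
       ({r i -` B \<inter> space M | i B. i \<le> k} \<union>
        {w i -` B \<inter> space M | i B. i < l \<and> B \<in> sets borel})"

definition markov_chain ::
  "'a measure \<Rightarrow> nat \<Rightarrow> (nat \<Rightarrow> nat \<Rightarrow> real) \<Rightarrow> (nat \<Rightarrow> 'a \<Rightarrow> nat) \<Rightarrow> bool" where
  "markov_chain M N lam r \<longleftrightarrow>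
     (\<forall>i \<in> {1..N}. (\<forall>j \<in> {1..N}. 0 \<le> lam i j) \<and> (\<Sum>j=1..N. lam i j) = 1) \<and>
     (\<forall>k. r k \<in> measurable M (count_space UNIV) \<and> (\<forall>\<omega> \<in> space M. r k \<omega> \<in> {1..N})) \<and>
     (\<forall>k s. \<forall>j \<in> {1..N}. 0 < \<P>(\<omega> in M. \<forall>i\<le>k. r i \<omega> = s i) \<longrightarrow>
        \<P>(\<omega> in M. r (Suc k) \<omega> = j \<bar> \<forall>i\<le>k. r i \<omega> = s i) = lam (s k) j)"

definition wide_sense_white_noise :: "'a measure \<Rightarrow> (nat \<Rightarrow> 'a \<Rightarrow> real) \<Rightarrow> bool" where
  "wide_sense_white_noise M w \<longleftrightarrow>
     (\<forall>k. w k \<in> borel_measurable M \<and> integrable M (\<lambda>\<omega>. (w k \<omega>)\<^sup>2)) \<and>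
     (\<forall>k. (\<integral>\<omega>. w k \<omega> \<partial>M) = 0) \<and>
     (\<forall>k s. (\<integral>\<omega>. w k \<omega> * w s \<omega> \<partial>M) = (if k = s then 1 else 0))"

text \<open>
  The moments of the noise and the transition law of the chain separately say nothing about their
  joint law, nor about the conditional law of \<open>w k\<close> given its past, and mean square stability
  depends on both. The usual convention is that the \<open>w k\<close> are independent and independent of the
  chain; only the following consequence is required: the first two moments of \<open>w k\<close> are not
  affected by conditioning on the past, and the transition law of the chain is not affected by
  conditioning on the noise up to the present.
\<close>

definition noise_compatible ::
  "'a measure \<Rightarrow> nat \<Rightarrow> (nat \<Rightarrow> nat \<Rightarrow> real) \<Rightarrow> (nat \<Rightarrow> 'a \<Rightarrow> nat) \<Rightarrow> (nat \<Rightarrow> 'a \<Rightarrow> real) \<Rightarrow> bool" where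
  "noise_compatible M N lam r w \<longleftrightarrow>
     (\<forall>k. (AE \<omega> in M. real_cond_exp M (history M r w k k) (w k) \<omega> = 0) \<and>
          (AE \<omega> in M. real_cond_exp M (history M r w k k) (\<lambda>\<omega>. (w k \<omega>)\<^sup>2) \<omega> = 1) \<and>
          (\<forall>j \<in> {1..N}. AE \<omega> in M.
             real_cond_exp M (history M r w k (Suc k))
               (indicat_real {\<omega> \<in> space M. r (Suc k) \<omega> = j}) \<omega> = lam (r k \<omega>) j))"

text \<open>
  \<open>x\<^sub>0\<close> is consistent with mode \<open>i\<close> and noise value \<open>u\<close> if \<open>E y = A(i) x\<^sub>0 + C(i) x\<^sub>0 u\<close> can be
  solved for the next state \<open>y\<close>.
\<close>

definition consistent_initial ::
  "nat \<Rightarrow> real mat \<Rightarrow> (nat \<Rightarrow> real mat) \<Rightarrow> (nat \<Rightarrow> real mat) \<Rightarrow> nat \<Rightarrow> real \<Rightarrow> real vec \<Rightarrow> bool" where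
  "consistent_initial n E A C i u x\<^sub>0 \<longleftrightarrow>
     (\<exists>y \<in> carrier_vec n. E *\<^sub>v y = A i *\<^sub>v x\<^sub>0 + u \<cdot>\<^sub>v (C i *\<^sub>v x\<^sub>0))"

text \<open>
  For singular \<open>E\<close> the equation at time \<open>0\<close> already constrains \<open>x 0\<close>, in a way depending on the
  initial mode, so \<open>x 0 = x\<^sub>0\<close> cannot be imposed for every vector \<open>x\<^sub>0\<close>. It is imposed wherever
  \<open>x\<^sub>0\<close> is consistent, and otherwise modulo the kernel of \<open>E\<close>, i.e. as \<open>E (x 0) = E x\<^sub>0\<close>.
\<close>

definition solution ::
  "'a measure \<Rightarrow> nat \<Rightarrow> real mat \<Rightarrow> (nat \<Rightarrow> real mat) \<Rightarrow> (nat \<Rightarrow> real mat) \<Rightarrow>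
   (nat \<Rightarrow> 'a \<Rightarrow> nat) \<Rightarrow> (nat \<Rightarrow> 'a \<Rightarrow> real) \<Rightarrow> real vec \<Rightarrow> (nat \<Rightarrow> 'a \<Rightarrow> real vec) \<Rightarrow> bool" where
  "solution M n E A C r w x\<^sub>0 x \<longleftrightarrow>
     (\<forall>k. \<forall>\<omega> \<in> space M. x k \<omega> \<in> carrier_vec n) \<and>
     (\<forall>k. \<forall>j<n. (\<lambda>\<omega>. x k \<omega> $ j) \<in> borel_measurable M) \<and>
     (AE \<omega> in M. E *\<^sub>v x 0 \<omega> = E *\<^sub>v x\<^sub>0 \<and>
        (consistent_initial n E A C (r 0 \<omega>) (w 0 \<omega>) x\<^sub>0 \<longrightarrow> x 0 \<omega> = x\<^sub>0)) \<and>
     (AE \<omega> in M. \<forall>k. E *\<^sub>v x (Suc k) \<omega> =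
        A (r k \<omega>) *\<^sub>v x k \<omega> + w k \<omega> \<cdot>\<^sub>v (C (r k \<omega>) *\<^sub>v x k \<omega>))"

text \<open>
  The solution has to be nonanticipating, but it is unique among all measurable processes.
\<close>

definition has_unique_solution ::
  "'a measure \<Rightarrow> nat \<Rightarrow> real mat \<Rightarrow> (nat \<Rightarrow> real mat) \<Rightarrow> (nat \<Rightarrow> real mat) \<Rightarrow>
   (nat \<Rightarrow> 'a \<Rightarrow> nat) \<Rightarrow> (nat \<Rightarrow> 'a \<Rightarrow> real) \<Rightarrow> bool" where
  "has_unique_solution M n E A C r w \<longleftrightarrow>
     (\<forall>x\<^sub>0 \<in> carrier_vec n. \<exists>x.
        solution M n E A C r w x\<^sub>0 x \<and>
        (\<forall>k. \<forall>j<n. (\<lambda>\<omega>. x k \<omega> $ j) \<in> borel_measurable (history M r w k k)) \<and>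
        (\<forall>y. solution M n E A C r w x\<^sub>0 y \<longrightarrow> (AE \<omega> in M. \<forall>k. y k \<omega> = x k \<omega>)))"

text \<open>
  As \<open>x\<^sub>0\<close> is deterministic, conditioning on \<open>(x\<^sub>0, r\<^sub>0)\<close> is conditioning on \<open>r\<^sub>0\<close>. The
  \<open>ennreal\<close>-valued conditional expectation is used since an infinite second moment would be
  turned into \<open>0\<close> by the real-valued one.
\<close>

definition mean_square_stable ::
  "'a measure \<Rightarrow> nat \<Rightarrow> real mat \<Rightarrow> (nat \<Rightarrow> real mat) \<Rightarrow> (nat \<Rightarrow> real mat) \<Rightarrow>
   (nat \<Rightarrow> 'a \<Rightarrow> nat) \<Rightarrow> (nat \<Rightarrow> 'a \<Rightarrow> real) \<Rightarrow> bool" where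
  "mean_square_stable M n E A C r w \<longleftrightarrow>
     has_unique_solution M n E A C r w \<and>
     (\<forall>x\<^sub>0 \<in> carrier_vec n. \<forall>x. solution M n E A C r w x\<^sub>0 x \<longrightarrow>
        (AE \<omega> in M.
           (\<lambda>k. nn_cond_exp M (history M r w 0 0) (\<lambda>\<omega>. ennreal (x k \<omega> \<bullet> x k \<omega>)) \<omega>)
             \<longlonglongrightarrow> 0))"

definition mean_square_admissible ::
  "'a measure \<Rightarrow> nat \<Rightarrow> nat \<Rightarrow> real mat \<Rightarrow> (nat \<Rightarrow> real mat) \<Rightarrow> (nat \<Rightarrow> real mat) \<Rightarrow>
   (nat \<Rightarrow> 'a \<Rightarrow> nat) \<Rightarrow> (nat \<Rightarrow> 'a \<Rightarrow> real) \<Rightarrow> bool" where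
  "mean_square_admissible M n N E A C r w \<longleftrightarrow>
     has_unique_solution M n E A C r w \<and> causal n N E A C \<and> mean_square_stable M n E A C r w"

end

theory Submission
  imports Defs
begin

text \<open>
  Write \<open>E = B K\<close> with \<open>B\<close> injective with \<open>rank E\<close> columns; the rank condition gives
  \<open>C(i) = B K'(i)\<close>, so \<open>F\<^sup>T\<close> annihilates \<open>E\<close>, \<open>B\<close> and \<open>C(i)\<close>. On \<open>ker E\<close> the inequality says that
  \<open>F\<^sup>T A(i) x \<noteq> 0\<close> for \<open>x \<noteq> 0\<close>. Hence \<open>K\<close> stacked on \<open>F\<^sup>T A(i)\<close> is injective, while \<open>B\<close> next to \<open>F\<close> is
  injective as well; comparing dimensions, both are square and invertible. The inverse
  \<open>[G R]\<close> of the former and the inverse of \<open>[B  A(i) R]\<close> bring the mode into the form (b).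

  Multiplying the system by \<open>F\<^sup>T\<close> gives \<open>F\<^sup>T A(r\<^sub>k) x(k) = 0\<close>, so \<open>x(k) = G(r\<^sub>k) \<xi>(k)\<close> with \<open>\<xi> = K x\<close>, and \<open>\<xi>\<close>
  satisfies an explicit recursion: this is existence and uniqueness. Along a solution the terms
  with \<open>F Q F\<^sup>T\<close> vanish, so the expectation of \<open>x\<^sup>T E\<^sup>T P(r\<^sub>k) E x\<close> decreases in each step by at least a
  multiple of the second moment of \<open>x(k)\<close>, and the second moments are summable.
\<close>

section \<open>Full-rank factorizations and block inverses\<close>

text \<open>\<open>Q\<close> may be indefinite, so the matrix inequality is no Lyapunov inequality
  on the whole space. It can be exploited only on the vectors with \<open>F^T A(i) x = 0\<close>,
  and this subspace depends on the mode: a switch of mode moves the state to another subspace. The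
  coordinates \<open>K x\<close> avoid the difficulty, because \<open>K G(i)\<close> is the identity
  for every \<open>i\<close>. In particular \<open>E x(k) = B xi(k)\<close>, and
  \<open>xi(k)\<close> involves only modes before time \<open>k\<close>. The Lyapunov value at time
  \<open>k+1\<close> therefore sees the new mode only through \<open>P\<close>, and averaging over
  that mode gives exactly \<open>\<Sum>j. lam i j * P(j)\<close>.

  The noise is controlled only through conditional moments, so each step takes two conditional
  expectations, in an order dictated by measurability: the new mode is averaged while the present
  noise is still known, and then the noise is averaged.\<close>

definition injective_mat :: "real mat \<Rightarrow> bool" where
  "injective_mat X \<longleftrightarrow> (\<forall>v \<in> carrier_vec (dim_col X). X *\<^sub>v v = 0\<^sub>v (dim_row X) \<longrightarrow> v = 0\<^sub>v (dim_col X))"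

lemma injective_matI:
  assumes "X \<in> carrier_mat n p"
    and "\<And>v. v \<in> carrier_vec p \<Longrightarrow> X *\<^sub>v v = 0\<^sub>v n \<Longrightarrow> v = 0\<^sub>v p"
  shows "injective_mat X"
  using assms by (auto simp: injective_mat_def)

lemma injective_matD:
  assumes "injective_mat X" "X \<in> carrier_mat n p" "v \<in> carrier_vec p" "X *\<^sub>v v = 0\<^sub>v n"
  shows "v = 0\<^sub>v p"
  using assms by (auto simp: injective_mat_def)

lemma injective_mat_cancel:
  assumes "injective_mat X" and X: "X \<in> carrier_mat n p"
    and u: "u \<in> carrier_vec p" and v: "v \<in> carrier_vec p" and eq: "X *\<^sub>v u = X *\<^sub>v v"
  shows "u = v"
proof -
  have "X *\<^sub>v (u - v) = 0\<^sub>v n"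
    using X u v eq by (simp add: mult_minus_distrib_mat_vec)
  then have "u - v = 0\<^sub>v p"
    using injective_matD[OF assms(1) X] u v by simp
  then show ?thesis
    using u v by (auto simp: vec_eq_iff)
qed

text \<open>Two equal columns would give two different unit vectors the same image. Linear
  independence is a property of the set of columns, where a repetition is invisible, so distinctness
  has to be supplied separately.\<close>

lemma distinct_cols_if_injective:
  assumes "injective_mat X" and X: "X \<in> carrier_mat n p"
  shows "distinct (cols X)"
proof (rule ccontr)
  assume "\<not> distinct (cols X)"
  then obtain i j where ij: "i < p" "j < p" "i \<noteq> j" "col X i = col X j"
    using X by (auto simp: distinct_conv_nth)
  have "X *\<^sub>v unit_vec p i = X *\<^sub>v unit_vec p j"
    using X ij by (intro eq_vecI) (auto simp: col_def vec_eq_iff)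
  then have "unit_vec p i = (unit_vec p j :: real vec)"
    using injective_mat_cancel[OF assms] by simp
  then show False
    using ij by (metis index_unit_vec(1) zero_neq_one)
qed

lemma injective_mat_dim_le:
  assumes inj: "injective_mat X" and X: "X \<in> carrier_mat n p"
  shows "p \<le> n"
proof -
  interpret vec_space "TYPE(real)" n .
  have d: "distinct (cols X)"
    using distinct_cols_if_injective[OF assms] .
  have "lin_indpt (set (cols X))"
    using lin_depE[OF X _ d] injective_matD[OF inj X] by metis
  then have "card (set (cols X)) \<le> dim"
    using li_le_dim(2)[of "set (cols X)"] cols_dim[of X] X by auto
  then show ?thesis
    using distinct_card[OF d] X by (simp add: dim_is_n)
qed

lemma injective_mat_inverse:
  assumes inj: "injective_mat X" and X: "X \<in> carrier_mat n n"
  obtains Y where "Y \<in> carrier_mat n n" "X * Y = 1\<^sub>m n" "Y * X = 1\<^sub>m n"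
proof -
  have "det X \<noteq> 0"
    using det_0_iff_vec_prod_zero[OF X] injective_matD[OF inj X] by blast
  from det_non_zero_imp_unit[OF X this, of "TYPE(real)"] that show thesis
    by (auto simp: Units_def ring_mat_def)
qed

text \<open>A maximal independent set of columns has as many elements as the rank. The columns of
  \<open>B\<close> are columns of \<open>X\<close> and not merely elements of its span, so
  \<open>B\<close> inherits identities that hold columnwise for \<open>X\<close>.\<close>

lemma rank_basis:
  assumes X: "X \<in> carrier_mat n c"
  obtains B where "B \<in> carrier_mat n (vec_space.rank n X)" "injective_mat B"
    "set (cols B) \<subseteq> set (cols X)"
proof -
  interpret vec_space "TYPE(real)" n .
  obtain S where S: "maximal S (\<lambda>T. T \<subseteq> set (cols X) \<and> lin_indpt T)"
    using maximal_exists[of "\<lambda>T. T \<subseteq> set (cols X) \<and> lin_indpt T" "card (set (cols X))" "{}"]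
    by (meson List.finite_set card_mono empty_iff empty_subsetI finite_lin_indpt2 rev_finite_subset)
  then have sub: "S \<subseteq> set (cols X)" and li: "lin_indpt S"
    by (auto simp: maximal_def)
  have carr: "S \<subseteq> carrier_vec n"
    using sub cols_dim[of X] X by auto
  obtain vs where vs: "set vs = S" "distinct vs"
    using finite_distinct_list[of S] finite_subset[OF sub] by auto
  have len: "length vs = rank X"
    using rank_card_indpt[OF X S] vs distinct_card by metis
  define B where "B = mat_of_cols n vs"
  have B: "B \<in> carrier_mat n (rank X)" "cols B = vs"
    using len vs carr by (auto simp: B_def)
  have "injective_mat B"
  proof (rule injective_matI[OF B(1)], rule ccontr)
    fix v assume "v \<in> carrier_vec (rank X)" "B *\<^sub>v v = 0\<^sub>v n" "v \<noteq> 0\<^sub>v (rank X)"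
    then have "lin_dep S"
      using lin_depI[OF B(1), of v] B(2) vs by auto
    then show False using li by simp
  qed
  then show thesis
    using that B vs sub by auto
qed

text \<open>A column of \<open>X\<close> outside the span of the columns of \<open>B\<close> could
  be added to them, giving more independent columns of \<open>X\<close> than its rank allows. Later
  \<open>B\<close> is taken from \<open>E\<close>, while \<open>X\<close> is the wider matrix
  \<open>[E C(i)]\<close>.\<close>

lemma col_in_range_if_full_rank:
  assumes X: "X \<in> carrier_mat n c" and B: "B \<in> carrier_mat n (vec_space.rank n X)"
    and inj: "injective_mat B" and sub: "set (cols B) \<subseteq> set (cols X)" and y: "y \<in> set (cols X)"
  obtains v where "v \<in> carrier_vec (vec_space.rank n X)" "B *\<^sub>v v = y"
proof -
  interpret vec_space "TYPE(real)" n .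
  have d: "distinct (cols B)"
    using distinct_cols_if_injective[OF inj B] .
  have li: "lin_indpt (set (cols B))"
    using lin_depE[OF B _ d] injective_matD[OF inj B] by metis
  have carr: "set (cols B) \<subseteq> carrier_vec n" and yc: "y \<in> carrier_vec n"
    using cols_dim[of B] cols_dim[of X] B X y by auto
  have "y \<in> span (set (cols B))"
  proof (rule ccontr)
    assume ny: "y \<notin> span (set (cols B))"
    then have "lin_indpt (set (cols B) \<union> {y})"
      using lin_dep_iff_in_span[OF carr li yc] span_mem[OF carr] by blast
    then have "card (set (cols B) \<union> {y}) \<le> rank X"
      using rank_ge_card_indpt[OF X] sub y by auto
    moreover have "card (set (cols B)) = rank X"
      using distinct_card[OF d] B by auto
    moreover have "y \<notin> set (cols B)"
      using ny span_mem[OF carr] by blast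
    ultimately show False by simp
  qed
  then obtain a where "y = lincomb a (set (cols B))"
    using finite_in_span[OF _ carr, of y] by auto
  then have "B *\<^sub>v vec (rank X) (\<lambda>i. a (col B i)) = y"
    using mat_mult_eq_lincomb[OF B d] by simp
  then show thesis
    using that[of "vec (rank X) (\<lambda>i. a (col B i))"] by simp
qed

text \<open>\<open>rank_basis\<close> finds \<open>p\<close> distinct columns among the
  \<open>p\<close> columns of \<open>X\<close>, so none is repeated; independence of the set of
  columns then becomes injectivity.\<close>

lemma injective_mat_if_full_rank:
  assumes X: "X \<in> carrier_mat n p" and rank: "vec_space.rank n X = p"
  shows "injective_mat X"
proof (rule injective_matI[OF X], rule ccontr)
  interpret vec_space "TYPE(real)" n .
  obtain B where B: "B \<in> carrier_mat n p" "injective_mat B" "set (cols B) \<subseteq> set (cols X)"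
    using rank_basis[OF X] rank by auto
  have "card (set (cols B)) = p"
    using distinct_card[OF distinct_cols_if_injective[OF B(2,1)]] B(1) by auto
  moreover have "card (set (cols X)) \<le> p"
    using card_length[of "cols X"] X by auto
  ultimately have c: "card (set (cols X)) = p"
    using card_mono[OF _ B(3)] by simp
  then have d: "distinct (cols X)"
    using X by (simp add: card_distinct)
  fix v assume "v \<in> carrier_vec p" "X *\<^sub>v v = 0\<^sub>v n" "v \<noteq> 0\<^sub>v p"
  then show False
    using lin_depI[OF X _ _ _ d] full_rank_lin_indpt[OF X rank d] by blast
qed

lemma factor_through_range:
  assumes B: "B \<in> carrier_mat n k" and Y: "Y \<in> carrier_mat n c"
    and range: "\<And>y. y \<in> set (cols Y) \<Longrightarrow> \<exists>v \<in> carrier_vec k. B *\<^sub>v v = y"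
  obtains K where "K \<in> carrier_mat k c" "Y = B * K"
proof -
  have "\<forall>j<c. \<exists>v. v \<in> carrier_vec k \<and> B *\<^sub>v v = col Y j"
    using range Y by (auto simp: cols_def Bex_def)
  then obtain f where f: "\<And>j. j < c \<Longrightarrow> f j \<in> carrier_vec k \<and> B *\<^sub>v f j = col Y j"
    by metis
  define K where "K = mat_of_cols k (map f [0..<c])"
  have K: "K \<in> carrier_mat k c" unfolding K_def using mat_of_cols_carrier(1)[of k "map f [0..<c]"] by simp
  have colK: "col K j = f j" if "j < c" for j
    using f that by (simp add: K_def)
  have "Y = B * K"
  proof (rule mat_col_eqI)
    fix j assume "j < dim_col (B * K)"
    then show "col Y j = col (B * K) j"
      using f[of j] colK[of j] K B col_mult2[OF B K, of j] by simp
  qed (use Y B K in auto)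
  with K show thesis using that by blast
qed

text \<open>Blocks side by side, and stacked blocks below, are encoded as four-block matrices whose
  remaining blocks have no rows or no columns, so that block multiplication applies
  directly.\<close>

definition hcat :: "real mat \<Rightarrow> real mat \<Rightarrow> real mat" where
  "hcat X Y = four_block_mat X Y (0\<^sub>m 0 (dim_col X)) (0\<^sub>m 0 (dim_col Y))"

definition vcat :: "real mat \<Rightarrow> real mat \<Rightarrow> real mat" where
  "vcat X Y = four_block_mat X (0\<^sub>m (dim_row X) 0) Y (0\<^sub>m (dim_row Y) 0)"

lemma hcat_carrier:
  "X \<in> carrier_mat n a \<Longrightarrow> Y \<in> carrier_mat n b \<Longrightarrow> hcat X Y \<in> carrier_mat n (a + b)"
  by (auto simp: hcat_def)

lemma vcat_carrier:
  "X \<in> carrier_mat a n \<Longrightarrow> Y \<in> carrier_mat b n \<Longrightarrow> vcat X Y \<in> carrier_mat (a + b) n"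
  by (auto simp: vcat_def)

lemma hcat_vcat:
  assumes "X \<in> carrier_mat n a" "Y \<in> carrier_mat n b" "U \<in> carrier_mat a p" "V \<in> carrier_mat b p"
  shows "hcat X Y * vcat U V = X * U + Y * V"
proof -
  have "hcat X Y * vcat U V =
    four_block_mat (X * U + Y * V) (0\<^sub>m n 0) (0\<^sub>m 0 p) (0\<^sub>m 0 0)"
    using assms unfolding hcat_def vcat_def
    by (subst mult_four_block_mat[of _ n a _ b _ 0 _ _ p _ 0]) auto
  also have "\<dots> = X * U + Y * V"
    using assms by (intro eq_matI) auto
  finally show ?thesis .
qed

text \<open>Supplies the block shape of \<open>L * Z * R\<close> in the causality form (b), with
  \<open>L\<close> split by rows and \<open>R\<close> by columns.\<close>

lemma vcat_mult_hcat:
  assumes "U \<in> carrier_mat a n" "V \<in> carrier_mat b n" "Z \<in> carrier_mat n p"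
    "X \<in> carrier_mat p c" "Y \<in> carrier_mat p d"
  shows "vcat U V * Z * hcat X Y = four_block_mat (U * Z * X) (U * Z * Y) (V * Z * X) (V * Z * Y)"
proof -
  have "Z = four_block_mat Z (0\<^sub>m n 0) (0\<^sub>m 0 p) (0\<^sub>m 0 0)"
    using assms by (intro eq_matI) auto
  then have "vcat U V * Z = vcat U V * four_block_mat Z (0\<^sub>m n 0) (0\<^sub>m 0 p) (0\<^sub>m 0 0)"
    by simp
  also have "\<dots> = four_block_mat (U * Z) (0\<^sub>m a 0) (V * Z) (0\<^sub>m b 0)"
    using assms unfolding vcat_def
    by (subst mult_four_block_mat[of _ a n _ 0 _ b _ _ p _ 0]) auto
  finally show ?thesis
    using assms unfolding hcat_def
    by (simp, subst mult_four_block_mat[of _ a p _ 0 _ b _ _ c _ d]) auto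
qed

lemma hcat_mult_append:
  assumes "X \<in> carrier_mat n a" "Y \<in> carrier_mat n b" "u \<in> carrier_vec a" "v \<in> carrier_vec b"
  shows "hcat X Y *\<^sub>v (u @\<^sub>v v) = X *\<^sub>v u + Y *\<^sub>v v"
proof -
  have "hcat X Y *\<^sub>v (u @\<^sub>v v) = (X *\<^sub>v u + Y *\<^sub>v v) @\<^sub>v (0\<^sub>m 0 a *\<^sub>v u + 0\<^sub>m 0 b *\<^sub>v v)"
    using assms unfolding hcat_def by (subst four_block_mat_mult_vec[of _ n a _ b _ 0]) auto
  also have "\<dots> = X *\<^sub>v u + Y *\<^sub>v v"
    using assms by (intro eq_vecI) auto
  finally show ?thesis .
qed

lemma vcat_mult_vec:
  assumes "X \<in> carrier_mat a n" "Y \<in> carrier_mat b n" "u \<in> carrier_vec n"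
  shows "vcat X Y *\<^sub>v u = (X *\<^sub>v u) @\<^sub>v (Y *\<^sub>v u)"
proof -
  have "u = u @\<^sub>v 0\<^sub>v 0"
    using assms by (intro eq_vecI) auto
  then have "vcat X Y *\<^sub>v u = vcat X Y *\<^sub>v (u @\<^sub>v 0\<^sub>v 0)"
    by simp
  also have "\<dots> = (X *\<^sub>v u + 0\<^sub>m a 0 *\<^sub>v 0\<^sub>v 0) @\<^sub>v (Y *\<^sub>v u + 0\<^sub>m b 0 *\<^sub>v 0\<^sub>v 0)"
    using assms unfolding vcat_def by (subst four_block_mat_mult_vec[of _ a n _ 0 _ b]) auto
  also have "\<dots> = (X *\<^sub>v u) @\<^sub>v (Y *\<^sub>v u)"
    using assms by (intro eq_vecI) auto
  finally show ?thesis .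
qed

lemma hcat_split:
  assumes "Z \<in> carrier_mat n (a + b)"
  obtains X Y where "X \<in> carrier_mat n a" "Y \<in> carrier_mat n b" "Z = hcat X Y"
proof
  show "Z = hcat (mat n a (\<lambda>(i, j). Z $$ (i, j))) (mat n b (\<lambda>(i, j). Z $$ (i, a + j)))"
    using assms by (intro eq_matI) (auto simp: hcat_def)
qed auto

lemma vcat_split:
  assumes "Z \<in> carrier_mat (a + b) n"
  obtains X Y where "X \<in> carrier_mat a n" "Y \<in> carrier_mat b n" "Z = vcat X Y"
proof
  show "Z = vcat (mat a n (\<lambda>(i, j). Z $$ (i, j))) (mat b n (\<lambda>(i, j). Z $$ (a + i, j)))"
    using assms by (intro eq_matI) (auto simp: vcat_def)
qed auto

lemma four_block_mat_inject:
  assumes "X1 \<in> carrier_mat a c" "X2 \<in> carrier_mat a d" "X3 \<in> carrier_mat b c" "X4 \<in> carrier_mat b d"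
    and "Y1 \<in> carrier_mat a c" "Y2 \<in> carrier_mat a d" "Y3 \<in> carrier_mat b c" "Y4 \<in> carrier_mat b d"
    and eq: "four_block_mat X1 X2 X3 X4 = four_block_mat Y1 Y2 Y3 Y4"
  shows "X1 = Y1 \<and> X2 = Y2 \<and> X3 = Y3 \<and> X4 = Y4"
proof -
  have entry: "four_block_mat X1 X2 X3 X4 $$ (i, j) = four_block_mat Y1 Y2 Y3 Y4 $$ (i, j)" for i j
    using eq by simp
  have "X1 $$ (i, j) = Y1 $$ (i, j)" if "i < a" "j < c" for i j
    using entry[of i j] that assms(1-8) by simp
  moreover have "X2 $$ (i, j) = Y2 $$ (i, j)" if "i < a" "j < d" for i j
    using entry[of i "c + j"] that assms(1-8) by simp
  moreover have "X3 $$ (i, j) = Y3 $$ (i, j)" if "i < b" "j < c" for i j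
    using entry[of "a + i" j] that assms(1-8) by simp
  moreover have "X4 $$ (i, j) = Y4 $$ (i, j)" if "i < b" "j < d" for i j
    using entry[of "a + i" "c + j"] that assms(1-8) by simp
  ultimately show ?thesis
    using assms(1-8) by auto
qed

lemma four_block_one:
  "1\<^sub>m (a + b) = four_block_mat (1\<^sub>m a) (0\<^sub>m a b) (0\<^sub>m b a) (1\<^sub>m b)"
  by (intro eq_matI) auto

lemma nonsingular_matI:
  assumes "X \<in> carrier_mat n n" "Y \<in> carrier_mat n n" "X * Y = 1\<^sub>m n" "Y * X = 1\<^sub>m n"
  shows "nonsingular_mat n X"
  using assms by (auto simp: nonsingular_mat_def invertible_mat_def inverts_mat_def)

lemma vcat_hcat_inverse:
  assumes "U \<in> carrier_mat a n" "V \<in> carrier_mat b n" "X \<in> carrier_mat n a" "Y \<in> carrier_mat n b"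
    and "vcat U V * hcat X Y = 1\<^sub>m (a + b)"
  shows "U * X = 1\<^sub>m a" "U * Y = 0\<^sub>m a b" "V * X = 0\<^sub>m b a" "V * Y = 1\<^sub>m b"
proof -
  have "four_block_mat (U * X) (U * Y) (V * X) (V * Y) =
      four_block_mat (1\<^sub>m a) (0\<^sub>m a b) (0\<^sub>m b a) (1\<^sub>m b)"
    using vcat_mult_hcat[OF assms(1,2) one_carrier_mat assms(3,4)]
      right_mult_one_mat[OF vcat_carrier[OF assms(1,2)]]
      right_mult_one_mat[OF assms(1)] right_mult_one_mat[OF assms(2)] assms(5) four_block_one
    by metis
  then have "U * X = 1\<^sub>m a \<and> U * Y = 0\<^sub>m a b \<and> V * X = 0\<^sub>m b a \<and> V * Y = 1\<^sub>m b"
    by (rule four_block_mat_inject[rotated 8]) (use assms(1-4) in auto)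
  then show "U * X = 1\<^sub>m a" "U * Y = 0\<^sub>m a b" "V * X = 0\<^sub>m b a" "V * Y = 1\<^sub>m b"
    by blast+
qed

lemma injective_hcat:
  assumes X: "X \<in> carrier_mat n a" and Y: "Y \<in> carrier_mat n b"
    and inj: "\<And>u v. u \<in> carrier_vec a \<Longrightarrow> v \<in> carrier_vec b \<Longrightarrow> X *\<^sub>v u + Y *\<^sub>v v = 0\<^sub>v n \<Longrightarrow>
      u = 0\<^sub>v a \<and> v = 0\<^sub>v b"
  shows "injective_mat (hcat X Y)"
proof (rule injective_matI[OF hcat_carrier[OF X Y]])
  fix x assume x: "x \<in> carrier_vec (a + b)" "hcat X Y *\<^sub>v x = 0\<^sub>v n"
  define u v where "u = vec_first x a" and "v = vec_last x b"
  have uv: "u \<in> carrier_vec a" "v \<in> carrier_vec b" "x = u @\<^sub>v v"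
    using x by (auto simp: u_def v_def)
  then have "u = 0\<^sub>v a \<and> v = 0\<^sub>v b"
    using inj[OF uv(1,2)] hcat_mult_append[OF X Y uv(1,2)] x by simp
  then show "x = 0\<^sub>v (a + b)"
    using uv by (auto simp: append_vec_def)
qed

lemma injective_vcat:
  assumes K: "K \<in> carrier_mat a n" and G: "G \<in> carrier_mat b n"
    and inj: "\<And>x. x \<in> carrier_vec n \<Longrightarrow> K *\<^sub>v x = 0\<^sub>v a \<Longrightarrow> G *\<^sub>v x = 0\<^sub>v b \<Longrightarrow> x = 0\<^sub>v n"
  shows "injective_mat (vcat K G)"
proof (rule injective_matI[OF vcat_carrier[OF K G]])
  fix x assume x: "x \<in> carrier_vec n" "vcat K G *\<^sub>v x = 0\<^sub>v (a + b)"
  then have "(K *\<^sub>v x) @\<^sub>v (G *\<^sub>v x) = 0\<^sub>v a @\<^sub>v 0\<^sub>v b"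
    using vcat_mult_vec[OF K G] by (auto simp: append_vec_def)
  then have "K *\<^sub>v x = 0\<^sub>v a \<and> G *\<^sub>v x = 0\<^sub>v b"
    using K x by (subst (asm) append_vec_eq[of _ a]) auto
  then show "x = 0\<^sub>v n"
    using inj x by blast
qed

text \<open>The two products of \<open>vcat K G\<close> with its inverse serve different ends: one
  yields the four block identities, the other decomposes the identity into a part through
  \<open>K\<close> and a part through \<open>G\<close>.\<close>

lemma complementary_inverse_rows:
  assumes K: "K \<in> carrier_mat a n" and G: "G \<in> carrier_mat b n" and dim: "a + b = n"
    and inj: "injective_mat (vcat K G)"
  obtains R1 R2 where "R1 \<in> carrier_mat n a" "R2 \<in> carrier_mat n b"
    "K * R1 = 1\<^sub>m a" "K * R2 = 0\<^sub>m a b" "G * R1 = 0\<^sub>m b a" "G * R2 = 1\<^sub>m b"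
    "R1 * K + R2 * G = 1\<^sub>m n" "nonsingular_mat n (hcat R1 R2)"
proof -
  have S: "vcat K G \<in> carrier_mat n n"
    using vcat_carrier[OF K G] dim by simp
  from injective_mat_inverse[OF inj S] obtain R where
    R: "R \<in> carrier_mat n n" "vcat K G * R = 1\<^sub>m n" "R * vcat K G = 1\<^sub>m n"
    by blast
  obtain R1 R2 where R12: "R1 \<in> carrier_mat n a" "R2 \<in> carrier_mat n b" "R = hcat R1 R2"
    using hcat_split[of R n a b] R dim by auto
  have "R1 * K + R2 * G = 1\<^sub>m n"
    using hcat_vcat[OF R12(1,2) K G] R R12 by simp
  moreover have "nonsingular_mat n (hcat R1 R2)"
    using nonsingular_matI[OF R(1) S] R R12 by simp
  ultimately show thesis
    using that[OF R12(1,2)] vcat_hcat_inverse[OF K G R12(1,2)] R R12 dim by simp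
qed

lemma complementary_inverse_cols:
  assumes X: "X \<in> carrier_mat n a" and Y: "Y \<in> carrier_mat n b" and dim: "a + b = n"
    and inj: "injective_mat (hcat X Y)"
  obtains L1 L2 where "L1 \<in> carrier_mat a n" "L2 \<in> carrier_mat b n"
    "L1 * X = 1\<^sub>m a" "L1 * Y = 0\<^sub>m a b" "L2 * X = 0\<^sub>m b a" "L2 * Y = 1\<^sub>m b"
    "X * L1 + Y * L2 = 1\<^sub>m n" "nonsingular_mat n (vcat L1 L2)"
proof -
  have S: "hcat X Y \<in> carrier_mat n n"
    using hcat_carrier[OF X Y] dim by simp
  from injective_mat_inverse[OF inj S] obtain L where
    L: "L \<in> carrier_mat n n" "hcat X Y * L = 1\<^sub>m n" "L * hcat X Y = 1\<^sub>m n"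
    by blast
  obtain L1 L2 where L12: "L1 \<in> carrier_mat a n" "L2 \<in> carrier_mat b n" "L = vcat L1 L2"
    using vcat_split[of L a b n] L dim by auto
  have "X * L1 + Y * L2 = 1\<^sub>m n"
    using hcat_vcat[OF X Y L12(1,2)] L L12 by simp
  moreover have "nonsingular_mat n (vcat L1 L2)"
    using nonsingular_matI[OF L(1) S] L L12 by simp
  ultimately show thesis
    using that[OF L12(1,2)] vcat_hcat_inverse[OF L12(1,2) X Y] L L12 dim by simp
qed

lemma mult_mat_zero_vec [simp]:
  "X \<in> carrier_mat n p \<Longrightarrow> X *\<^sub>v 0\<^sub>v p = (0\<^sub>v n :: real vec)"
  by (intro eq_vecI) auto

lemma mult_zero_mat_vec [simp]:
  "v \<in> carrier_vec p \<Longrightarrow> 0\<^sub>m n p *\<^sub>v v = (0\<^sub>v n :: real vec)"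
  by (intro eq_vecI) auto

lemma smult_vec_zero: "c \<cdot>\<^sub>v 0\<^sub>v n = (0\<^sub>v n :: real vec)"
  by (intro eq_vecI) auto

lemma scalar_prod_self:
  fixes v :: "real vec"
  assumes "v \<in> carrier_vec n"
  shows "v \<bullet> v = (\<Sum>i<n. (v $ i)\<^sup>2)"
  using assms by (auto simp: scalar_prod_def power2_eq_square atLeast0LessThan)

lemma scalar_prod_self_eq_0:
  fixes v :: "real vec"
  assumes "v \<in> carrier_vec n" "v \<bullet> v = 0"
  shows "v = 0\<^sub>v n"
  using assms scalar_prod_self[OF assms(1)] by (intro eq_vecI) (auto simp: sum_nonneg_eq_0_iff)

text \<open>The scalar product of \<open>F^T F v\<close> with \<open>v\<close> is the squared norm
  of \<open>F v\<close>. Thus the range of \<open>F\<close> meets the kernel of \<open>F^T\<close>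
  only in zero.\<close>

lemma injective_gram:
  assumes F: "F \<in> carrier_mat n m" and inj: "injective_mat F" and v: "v \<in> carrier_vec m"
    and zero: "transpose_mat F *\<^sub>v (F *\<^sub>v v) = 0\<^sub>v m"
  shows "v = 0\<^sub>v m"
proof -
  have Fv: "F *\<^sub>v v \<in> carrier_vec n"
    using F v by simp
  have "(F *\<^sub>v v) \<bullet> (F *\<^sub>v v) = (transpose_mat F *\<^sub>v (F *\<^sub>v v)) \<bullet> v"
    using transpose_vec_mult_scalar[OF F v Fv] by simp
  also have "\<dots> = 0"
    using zero v by simp
  finally have "F *\<^sub>v v = 0\<^sub>v n"
    using scalar_prod_self_eq_0[OF Fv] by simp
  then show ?thesis
    using injective_matD[OF inj F v] by simp
qed

section \<open>Factoring the coefficient matrices through a common column basis\<close>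

lemma mat_eqI_cols:
  assumes "X \<in> carrier_mat n p" "Y \<in> carrier_mat n p" "\<And>j. j < p \<Longrightarrow> col X j = col Y j"
  shows "X = Y"
  using assms by (intro mat_col_eqI) auto

lemma rank_factorization:
  assumes E: "E \<in> carrier_mat n n"
  obtains B K where "B \<in> carrier_mat n (vec_space.rank n E)" "K \<in> carrier_mat (vec_space.rank n E) n"
    "injective_mat B" "set (cols B) \<subseteq> set (cols E)" "E = B * K"
proof -
  obtain B where B: "B \<in> carrier_mat n (vec_space.rank n E)" "injective_mat B"
    "set (cols B) \<subseteq> set (cols E)"
    using rank_basis[OF E] .
  obtain K where "K \<in> carrier_mat (vec_space.rank n E) n" "E = B * K"
    using factor_through_range[OF B(1) E] col_in_range_if_full_rank[OF E B] by metis
  then show thesis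
    using that B by blast
qed

text \<open>The factorization \<open>E = B * K\<close> alone would only show that
  \<open>F^T B K\<close> vanishes. As the columns of \<open>B\<close> are themselves columns of
  \<open>E\<close>, the claim follows column by column, without surjectivity of
  \<open>K\<close>.\<close>

lemma annihilator_range_basis:
  fixes E F :: "real mat"
  assumes E: "E \<in> carrier_mat n n" and F: "F \<in> carrier_mat n m"
    and EF: "transpose_mat E * F = 0\<^sub>m n m"
    and B: "B \<in> carrier_mat n k" and colsB: "set (cols B) \<subseteq> set (cols E)"
  shows "transpose_mat F * B = 0\<^sub>m m k"
proof -
  define Ft where "Ft = transpose_mat F"
  have Ft: "Ft \<in> carrier_mat m n"
    using F by (simp add: Ft_def)
  have FtE: "Ft * E = 0\<^sub>m m n"
    using arg_cong[OF EF, of transpose_mat] transpose_mult[of "transpose_mat E" n n F m] E F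
    by (simp add: Ft_def)
  have "Ft * B = 0\<^sub>m m k"
  proof (rule mat_eqI_cols)
    fix j assume j: "j < k"
    have "col B j \<in> set (cols B)"
      using j B by (auto simp: cols_def)
    then obtain i where i: "i < n" "col B j = col E i"
      using colsB E by (auto simp: cols_def)
    have "col (Ft * B) j = Ft *\<^sub>v col E i"
      using col_mult2[OF Ft B j] i by simp
    also have "\<dots> = col (0\<^sub>m m n) i"
      using col_mult2[OF Ft E i(1)] FtE by simp
    finally show "col (Ft * B) j = col (0\<^sub>m m k) j"
      using i j by simp
  qed (use Ft B in auto)
  then show ?thesis by (simp add: Ft_def)
qed

text \<open>The \<open>k\<close> independent columns of \<open>B\<close> are among those of
  \<open>[E C]\<close>. That matrix still has rank \<open>k\<close>, so they span its column space,
  which contains the columns of \<open>C\<close>.\<close>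

lemma factor_through_rank_condition:
  fixes E C :: "real mat"
  assumes E: "E \<in> carrier_mat n n" and C: "C \<in> carrier_mat n n"
    and rank_EC: "vec_space.rank n (mat_of_cols n (cols E @ cols C)) = k"
    and B: "B \<in> carrier_mat n k" and injB: "injective_mat B"
    and colsB: "set (cols B) \<subseteq> set (cols E)"
  obtains KC where "KC \<in> carrier_mat k n" "C = B * KC"
proof -
  define X where "X = mat_of_cols n (cols E @ cols C)"
  have X: "X \<in> carrier_mat n (n + n)"
    using mat_of_cols_carrier(1)[of n "cols E @ cols C"] E C by (simp add: X_def)
  have cX: "set (cols X) = set (cols E) \<union> set (cols C)"
    using cols_dim[of E] cols_dim[of C] E C unfolding X_def by (subst cols_mat_of_cols) auto
  have rX: "vec_space.rank n X = k"
    using rank_EC by (simp add: X_def)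
  have BX: "B \<in> carrier_mat n (vec_space.rank n X)" and sub: "set (cols B) \<subseteq> set (cols X)"
    using B rX colsB cX by auto
  have "\<exists>v \<in> carrier_vec k. B *\<^sub>v v = y" if "y \<in> set (cols C)" for y
    using col_in_range_if_full_rank[OF X BX injB sub, of y] rX cX that by blast
  then show thesis
    using factor_through_range[OF B C] that by blast
qed

text \<open>The algebra of a single mode. \<open>G\<close> parametrizes the states with
  \<open>F^T A x = 0\<close>; \<open>H\<close> and \<open>H'\<close> are the drift and diffusion
  coefficients of the recursion in the coordinates \<open>K x\<close>. The matrix inequality enters
  only through \<open>ker\<close>.\<close>

lemma causal_reduction:
  fixes E A C F :: "real mat"
  assumes E: "E \<in> carrier_mat n n" and A: "A \<in> carrier_mat n n" and C: "C \<in> carrier_mat n n"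
    and F: "F \<in> carrier_mat n m" and injF: "injective_mat F"
    and k: "k = vec_space.rank n E"
    and B: "B \<in> carrier_mat n k" and K: "K \<in> carrier_mat k n" and KC: "KC \<in> carrier_mat k n"
    and injB: "injective_mat B" and EBK: "E = B * K" and CBK: "C = B * KC"
    and FB: "transpose_mat F * B = 0\<^sub>m m k"
    and ker: "\<And>x. x \<in> carrier_vec n \<Longrightarrow> E *\<^sub>v x = 0\<^sub>v n \<Longrightarrow>
      transpose_mat F *\<^sub>v (A *\<^sub>v x) = 0\<^sub>v m \<Longrightarrow> x = 0\<^sub>v n"
  obtains G H H' where "causal_b n E A C"
    "G \<in> carrier_mat n k" "H \<in> carrier_mat k k" "H' \<in> carrier_mat k k"
    "K * G = 1\<^sub>m k" "A * G = B * H" "C * G = B * H'"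
    "\<And>x y u. x \<in> carrier_vec n \<Longrightarrow> y \<in> carrier_vec n \<Longrightarrow>
      E *\<^sub>v y = A *\<^sub>v x + u \<cdot>\<^sub>v (C *\<^sub>v x) \<Longrightarrow> x = G *\<^sub>v (K *\<^sub>v x)"
proof -
  define Ft where "Ft = transpose_mat F"
  have Ft: "Ft \<in> carrier_mat m n"
    using F by (simp add: Ft_def)
  have FtB: "Ft * B = 0\<^sub>m m k"
    using FB by (simp add: Ft_def)
  have FtE: "Ft * E = 0\<^sub>m m n"
    using assoc_mult_mat[OF Ft B K] FtB EBK K by simp
  define D where "D = Ft * A"
  have D: "D \<in> carrier_mat m n"
    using Ft A by (simp add: D_def)
  have Dv: "D *\<^sub>v x = Ft *\<^sub>v (A *\<^sub>v x)" if "x \<in> carrier_vec n" for x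
    using Ft A that by (simp add: D_def)
  have injKD: "injective_mat (vcat K D)"
  proof (rule injective_vcat[OF K D])
    fix x assume x: "x \<in> carrier_vec n" "K *\<^sub>v x = 0\<^sub>v k" "D *\<^sub>v x = 0\<^sub>v m"
    have "E *\<^sub>v x = B *\<^sub>v (K *\<^sub>v x)"
      using EBK B K x by simp
    then have "E *\<^sub>v x = 0\<^sub>v n"
      using x B by simp
    then show "x = 0\<^sub>v n"
      using ker[OF x(1)] x Dv by (simp add: Ft_def)
  qed
  have injBF: "injective_mat (hcat B F)"
  proof (rule injective_hcat[OF B F])
    fix u v assume u: "u \<in> carrier_vec k" and v: "v \<in> carrier_vec m" and eq: "B *\<^sub>v u + F *\<^sub>v v = 0\<^sub>v n"
    have "Ft *\<^sub>v (B *\<^sub>v u + F *\<^sub>v v) = Ft *\<^sub>v (B *\<^sub>v u) + Ft *\<^sub>v (F *\<^sub>v v)"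
      using Ft B F u v by (intro mult_add_distrib_mat_vec) auto
    moreover have "Ft *\<^sub>v (B *\<^sub>v u) = 0\<^sub>v m"
      using assoc_mult_mat_vec[OF Ft B u] FtB u by simp
    ultimately have "Ft *\<^sub>v (F *\<^sub>v v) = 0\<^sub>v m"
      using eq Ft F v by simp
    then have v0: "v = 0\<^sub>v m"
      using injective_gram[OF F injF v] by (simp add: Ft_def)
    have "B *\<^sub>v u = 0\<^sub>v n"
      using eq v0 B F u by simp
    then show "u = 0\<^sub>v k \<and> v = 0\<^sub>v m"
      using injective_matD[OF injB B u] v0 by simp
  qed
  have "k + m \<le> n"
    using injective_mat_dim_le[OF injBF hcat_carrier[OF B F]] .
  moreover have "n \<le> k + m"
    using injective_mat_dim_le[OF injKD vcat_carrier[OF K D]] .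
  ultimately have dim: "k + m = n" by simp
  then have nk: "n - k = m" by simp
  obtain L1 L2 where L: "L1 \<in> carrier_mat k n" "L2 \<in> carrier_mat m n" "B * L1 + F * L2 = 1\<^sub>m n"
    using complementary_inverse_cols[OF B F dim injBF] by metis
  \<comment> \<open>In the splitting of \<open>y\<close> into a part in the range of
    \<open>B\<close> and a part in the range of \<open>F\<close>, applying \<open>F^T\<close>
    removes the first part; so \<open>F^T y = 0\<close> forces the second to vanish. The kernel of
    \<open>F^T\<close> is the range of \<open>B\<close>.\<close>
  have range: "B *\<^sub>v (L1 *\<^sub>v y) = y" if y: "y \<in> carrier_vec n" "Ft *\<^sub>v y = 0\<^sub>v m" for y
  proof -
    have L1y: "L1 *\<^sub>v y \<in> carrier_vec k" and L2y: "L2 *\<^sub>v y \<in> carrier_vec m"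
      using L y by auto
    have "y = (B * L1 + F * L2) *\<^sub>v y"
      using L y by simp
    also have "\<dots> = B *\<^sub>v (L1 *\<^sub>v y) + F *\<^sub>v (L2 *\<^sub>v y)"
      using L y B F by (subst add_mult_distrib_mat_vec[of _ n n]) auto
    finally have dec: "y = B *\<^sub>v (L1 *\<^sub>v y) + F *\<^sub>v (L2 *\<^sub>v y)" .
    have "Ft *\<^sub>v (B *\<^sub>v (L1 *\<^sub>v y) + F *\<^sub>v (L2 *\<^sub>v y)) =
        Ft *\<^sub>v (B *\<^sub>v (L1 *\<^sub>v y)) + Ft *\<^sub>v (F *\<^sub>v (L2 *\<^sub>v y))"
      using Ft B F L1y L2y by (intro mult_add_distrib_mat_vec) auto
    moreover have "Ft *\<^sub>v (B *\<^sub>v (L1 *\<^sub>v y)) = 0\<^sub>v m"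
      using assoc_mult_mat_vec[OF Ft B L1y] FtB L1y by simp
    ultimately have "Ft *\<^sub>v (F *\<^sub>v (L2 *\<^sub>v y)) = 0\<^sub>v m"
      using y(2) dec Ft F L2y by simp
    then have "L2 *\<^sub>v y = 0\<^sub>v m"
      using injective_gram[OF F injF L2y] by (simp add: Ft_def)
    then show ?thesis
      using dec F B L1y by simp
  qed
  obtain G R2 where G: "G \<in> carrier_mat n k" and R2: "R2 \<in> carrier_mat n m"
    and KG: "K * G = 1\<^sub>m k" and KR2: "K * R2 = 0\<^sub>m k m"
    and DG: "D * G = 0\<^sub>m m k" and DR2: "D * R2 = 1\<^sub>m m"
    and GR2: "G * K + R2 * D = 1\<^sub>m n" and nonR: "nonsingular_mat n (hcat G R2)"
    using complementary_inverse_rows[OF K D dim injKD] by metis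
  \<comment> \<open>The inverse of \<open>hcat B F\<close> would in general leave a coupling block
    in the transformed \<open>A\<close> and a lower right block other than the identity. Putting
    \<open>A * R2\<close> in the place of \<open>F\<close> normalizes both, and
    \<open>Ft * (A * R2) = 1\<close> keeps the columns independent.\<close>
  have AR2: "A * R2 \<in> carrier_mat n m"
    using A R2 by simp
  have FtAR2: "Ft * (A * R2) = 1\<^sub>m m"
    using assoc_mult_mat[OF Ft A R2] DR2 by (simp add: D_def)
  have injBAR2: "injective_mat (hcat B (A * R2))"
  proof (rule injective_hcat[OF B AR2])
    fix u v assume u: "u \<in> carrier_vec k" and v: "v \<in> carrier_vec m"
      and eq: "B *\<^sub>v u + (A * R2) *\<^sub>v v = 0\<^sub>v n"
    have "Ft *\<^sub>v (B *\<^sub>v u + (A * R2) *\<^sub>v v) = Ft *\<^sub>v (B *\<^sub>v u) + Ft *\<^sub>v ((A * R2) *\<^sub>v v)"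
      by (rule mult_add_distrib_mat_vec[OF Ft mult_mat_vec_carrier[OF B u] mult_mat_vec_carrier[OF AR2 v]])
    moreover have "Ft *\<^sub>v (B *\<^sub>v u) = 0\<^sub>v m"
      using assoc_mult_mat_vec[OF Ft B u] FtB u by simp
    moreover have "Ft *\<^sub>v ((A * R2) *\<^sub>v v) = v"
      using assoc_mult_mat_vec[OF Ft AR2 v] FtAR2 v by simp
    ultimately have v0: "v = 0\<^sub>v m"
      using eq Ft v by simp
    have "(A * R2) *\<^sub>v v = 0\<^sub>v n"
      using v0 mult_mat_zero_vec[OF AR2] by simp
    then have "B *\<^sub>v u = 0\<^sub>v n"
      using eq mult_mat_vec_carrier[OF B u] by simp
    then show "u = 0\<^sub>v k \<and> v = 0\<^sub>v m"
      using injective_matD[OF injB B u] v0 by simp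
  qed
  obtain P1 P2 where P: "P1 \<in> carrier_mat k n" "P2 \<in> carrier_mat m n"
    and PB: "P1 * B = 1\<^sub>m k" "P2 * B = 0\<^sub>m m k"
    and PA: "P1 * (A * R2) = 0\<^sub>m k m" "P2 * (A * R2) = 1\<^sub>m m"
    and nonP: "nonsingular_mat n (vcat P1 P2)"
    using complementary_inverse_cols[OF B AR2 dim injBAR2] by metis
  \<comment> \<open>By \<open>D * G = 0\<close> the columns of \<open>A * G\<close> lie in the
    kernel of \<open>F^T\<close>, hence in the range of \<open>B\<close>; \<open>L1\<close> reads
    off their coordinates.\<close>
  define H where "H = L1 * (A * G)"
  have AG: "A * G \<in> carrier_mat n k" and H: "H \<in> carrier_mat k k"
    using A G L by (auto simp: H_def)
  have FtAG: "Ft * (A * G) = 0\<^sub>m m k"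
    using assoc_mult_mat[OF Ft A G] DG by (simp add: D_def)
  have AGH: "A * G = B * H"
  proof (rule mat_eqI_cols[OF AG])
    fix j assume j: "j < k"
    have "Ft *\<^sub>v col (A * G) j = 0\<^sub>v m"
      using col_mult2[OF Ft AG j] FtAG j by simp
    then have "B *\<^sub>v (L1 *\<^sub>v col (A * G) j) = col (A * G) j"
      using range[of "col (A * G) j"] col_carrier_vec[OF j AG] by blast
    then show "col (A * G) j = col (B * H) j"
      using col_mult2[OF B H j] col_mult2[OF L(1) AG j] by (simp add: H_def)
  qed (use B H in auto)
  have CGH: "C * G = B * (KC * G)"
    using KC B G CBK by simp
  \<comment> \<open>The constraint \<open>D x = 0\<close> deletes the second part of
    \<open>G * K + R2 * D = 1\<close>. The vector \<open>y\<close> only witnesses that the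
    right-hand side lies in the range of \<open>E\<close>.\<close>
  have sol: "x = G *\<^sub>v (K *\<^sub>v x)"
    if x: "x \<in> carrier_vec n" and y: "y \<in> carrier_vec n"
      and eq: "E *\<^sub>v y = A *\<^sub>v x + u \<cdot>\<^sub>v (C *\<^sub>v x)" for x y u
  proof -
    have KCx: "KC *\<^sub>v x \<in> carrier_vec k" and Ax: "A *\<^sub>v x \<in> carrier_vec n"
      and Cx: "C *\<^sub>v x \<in> carrier_vec n"
      using KC A C x by auto
    have "Ft *\<^sub>v (E *\<^sub>v y) = 0\<^sub>v m"
      using assoc_mult_mat_vec[OF Ft E y] FtE y by simp
    moreover have "Ft *\<^sub>v (A *\<^sub>v x + u \<cdot>\<^sub>v (C *\<^sub>v x)) = Ft *\<^sub>v (A *\<^sub>v x) + Ft *\<^sub>v (u \<cdot>\<^sub>v (C *\<^sub>v x))"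
      using Ft Ax Cx by (intro mult_add_distrib_mat_vec) auto
    moreover have "Ft *\<^sub>v (u \<cdot>\<^sub>v (C *\<^sub>v x)) = 0\<^sub>v m"
    proof -
      have "Ft *\<^sub>v (C *\<^sub>v x) = Ft *\<^sub>v (B *\<^sub>v (KC *\<^sub>v x))"
        using KC B x CBK by simp
      also have "\<dots> = 0\<^sub>v m"
        using assoc_mult_mat_vec[OF Ft B KCx] FtB KCx by simp
      finally show ?thesis
        using mult_mat_vec[OF Ft Cx, of u] by (simp add: smult_vec_zero)
    qed
    ultimately have "D *\<^sub>v x = 0\<^sub>v m"
      using eq Dv[OF x] Ft Ax by simp
    moreover have "x = (G * K + R2 * D) *\<^sub>v x"
      using GR2 x by simp
    moreover have "(G * K + R2 * D) *\<^sub>v x = G *\<^sub>v (K *\<^sub>v x) + R2 *\<^sub>v (D *\<^sub>v x)"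
      using G K R2 D x by (subst add_mult_distrib_mat_vec[of _ n n]) auto
    ultimately show ?thesis
      using G K R2 x by simp
  qed
  have blockE: "vcat P1 P2 * E * hcat G R2 =
      four_block_mat (1\<^sub>m k) (0\<^sub>m k m) (0\<^sub>m m k) (0\<^sub>m m m)"
  proof -
    have 1: "P1 * E = K" "P2 * E = 0\<^sub>m m n"
      using assoc_mult_mat[OF P(1) B K] assoc_mult_mat[OF P(2) B K] PB K EBK by simp_all
    show ?thesis
      unfolding vcat_mult_hcat[OF P E G R2] 1 using KG KR2 G R2 by simp
  qed
  have blockA: "vcat P1 P2 * A * hcat G R2 = four_block_mat H (0\<^sub>m k m) (0\<^sub>m m k) (1\<^sub>m m)"
  proof -
    have 1: "P1 * A * G = H" "P2 * A * G = 0\<^sub>m m k"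
      using assoc_mult_mat[OF P(1) A G] assoc_mult_mat[OF P(2) A G]
        assoc_mult_mat[OF P(1) B H] assoc_mult_mat[OF P(2) B H] PB H AGH by simp_all
    have 2: "P1 * A * R2 = 0\<^sub>m k m" "P2 * A * R2 = 1\<^sub>m m"
      using assoc_mult_mat[OF P(1) A R2] assoc_mult_mat[OF P(2) A R2] PA by simp_all
    show ?thesis
      unfolding vcat_mult_hcat[OF P A G R2] 1 2 ..
  qed
  \<comment> \<open>\<open>P2\<close> annihilates the range of \<open>B\<close>, which contains that
    of \<open>C\<close>; the block \<open>C22\<close> of form (b) is therefore zero.\<close>
  have blockC: "vcat P1 P2 * C * hcat G R2 =
      four_block_mat (KC * G) (KC * R2) (0\<^sub>m m k) (0\<^sub>m m m)"
  proof -
    have 1: "P1 * C = KC" "P2 * C = 0\<^sub>m m n"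
      using assoc_mult_mat[OF P(1) B KC] assoc_mult_mat[OF P(2) B KC] PB KC CBK by simp_all
    show ?thesis
      unfolding vcat_mult_hcat[OF P C G R2] 1 using G R2 by simp
  qed
  have causal: "causal_b n E A C"
    unfolding causal_b_def Let_def k[symmetric] nk
    by (intro exI[of _ "vcat P1 P2"] exI[of _ "hcat G R2"] exI[of _ H] exI[of _ "KC * G"]
        exI[of _ "KC * R2"] exI[of _ "0\<^sub>m m m"] conjI nonP nonR H mult_carrier_mat[OF KC G]
        mult_carrier_mat[OF KC R2] zero_carrier_mat blockE blockA blockC)
  show thesis
  proof (rule that[OF causal G H mult_carrier_mat[OF KC G] KG AGH CGH])
    fix x y u
    assume "x \<in> carrier_vec n" "y \<in> carrier_vec n" "E *\<^sub>v y = A *\<^sub>v x + u \<cdot>\<^sub>v (C *\<^sub>v x)"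
    then show "x = G *\<^sub>v (K *\<^sub>v x)"
      by (rule sol)
  qed
qed

section \<open>Quadratic forms\<close>

text \<open>The form attains a negative maximum on the compact unit sphere, and it is homogeneous of
  degree 2. The uniform constant is what later makes the second moments summable.\<close>

lemma neg_def_mat_bound:
  assumes X: "neg_def_mat n X"
  obtains e where "e > 0" "\<And>v. v \<in> carrier_vec n \<Longrightarrow> v \<bullet> (X *\<^sub>v v) \<le> - e * (v \<bullet> v)"
proof -
  have Xc: "X \<in> carrier_mat n n"
    and neg: "\<And>v. v \<in> carrier_vec n \<Longrightarrow> v \<noteq> 0\<^sub>v n \<Longrightarrow> v \<bullet> (X *\<^sub>v v) < 0"
    using X by (auto simp: neg_def_mat_def)
  define q where "q f = (\<Sum>i<n. \<Sum>j<n. f i * (X $$ (i, j) * f j))" for f :: "nat \<Rightarrow> real"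
  have q: "v \<bullet> (X *\<^sub>v v) = q (\<lambda>i. v $ i)" if "v \<in> carrier_vec n" for v
    using that Xc by (auto simp: q_def scalar_prod_def sum_distrib_left atLeast0LessThan)
  \<comment> \<open>Vectors are replaced by functions on \<open>nat\<close> that vanish from index
    \<open>n\<close> on: the box \<open>K\<close> is a product of compact sets, and the sphere
    \<open>S\<close> is a closed part of it.\<close>
  define K where "K = PiE UNIV (\<lambda>i. if i < n then {-1..1 :: real} else {0})"
  define S where "S = K \<inter> {f. (\<Sum>i<n. (f i)\<^sup>2) = 1}"
  have cont [continuous_intros]: "continuous_on T (\<lambda>f :: nat \<Rightarrow> real. f i)" for T i
    by (rule continuous_on_subset[OF continuous_on_product_coordinates]) simp
  have "compact K"
    unfolding K_def compactin_euclidean_iff[symmetric] euclidean_product_topology[symmetric]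
    by (subst compactin_PiE) auto
  moreover have "closed {f :: nat \<Rightarrow> real. (\<Sum>i<n. (f i)\<^sup>2) = 1}"
    by (intro closed_Collect_eq continuous_intros)
  ultimately have "compact S"
    unfolding S_def by (rule compact_Int_closed)
  moreover have "continuous_on S q"
    unfolding q_def by (intro continuous_intros)
  ultimately have bound: "\<exists>e>0. \<forall>f\<in>S. q f \<le> - e"
  proof (cases "S = {}")
    case False
    assume "compact S" "continuous_on S q"
    then obtain g where g: "g \<in> S" "\<And>f. f \<in> S \<Longrightarrow> q f \<le> q g"
      using continuous_attains_sup[OF _ False] by metis
    have "vec n g \<noteq> 0\<^sub>v n"
    proof
      assume "vec n g = 0\<^sub>v n"
      then have "g i = 0" if "i < n" for i
        using that by (metis index_vec index_zero_vec(1))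
      then show False
        using g(1) by (simp add: S_def)
    qed
    then have "q (\<lambda>i. vec n g $ i) < 0"
      using neg[of "vec n g"] q[of "vec n g"] by simp
    moreover have "q (\<lambda>i. vec n g $ i) = q g"
      by (simp add: q_def)
    ultimately show ?thesis
      using g by (intro exI[of _ "- q g"]) auto
  \<comment> \<open>The sphere is empty only for \<open>n = 0\<close>, where any positive constant
    serves.\<close>
  qed (auto intro: exI[of _ 1])
  then obtain e where e: "e > 0" "\<And>f. f \<in> S \<Longrightarrow> q f \<le> - e"
    by blast
  have "v \<bullet> (X *\<^sub>v v) \<le> - e * (v \<bullet> v)" if v: "v \<in> carrier_vec n" for v
  proof (cases "v = 0\<^sub>v n")
    case True
    then show ?thesis using Xc by simp
  next
    case False
    define s where "s = v \<bullet> v"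
    have s_sum: "s = (\<Sum>i<n. (v $ i)\<^sup>2)"
      using scalar_prod_self[OF v] by (simp add: s_def)
    have s: "s > 0"
      using scalar_prod_self_eq_0[OF v] False s_sum sum_nonneg[of "{..<n}" "\<lambda>i. (v $ i)\<^sup>2"]
      by (auto simp: s_def less_le)
    define f where "f i = (if i < n then v $ i / sqrt s else 0)" for i
    have f1: "(\<Sum>i<n. (f i)\<^sup>2) = 1"
      using s by (simp add: f_def power_divide sum_divide_distrib[symmetric] s_sum[symmetric])
    have "f i \<in> {-1..1}" if "i < n" for i
    proof -
      have "(f i)\<^sup>2 \<le> 1"
        using member_le_sum[of i "{..<n}" "\<lambda>i. (f i)\<^sup>2"] that f1 by simp
      then show ?thesis
        by (simp add: abs_square_le_1 abs_le_iff)
    qed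
    moreover have "f i = 0" if "\<not> i < n" for i
      using that by (simp add: f_def)
    ultimately have "f \<in> S"
      using f1 by (auto simp: S_def K_def)
    from e(2)[OF this] have "q f \<le> - e" .
    moreover have "q f = q (\<lambda>i. v $ i) / s"
      using s by (simp add: q_def f_def sum_divide_distrib)
    ultimately show ?thesis
      using s q[OF v] by (simp add: divide_le_eq s_def)
  qed
  with e(1) show thesis using that by blast
qed

lemma mode_average_carrier [simp]: "mode_average n N lam P i \<in> carrier_mat n n"
  by (simp add: mode_average_def)

lemma quadratic_form_mode_average:
  assumes P: "\<And>j. j \<in> {1..N} \<Longrightarrow> P j \<in> carrier_mat n n" and y: "y \<in> carrier_vec n"
  shows "y \<bullet> (mode_average n N lam P i *\<^sub>v y) = (\<Sum>j=1..N. lam i j * (y \<bullet> (P j *\<^sub>v y)))"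
proof -
  have q: "y \<bullet> (X *\<^sub>v y) = (\<Sum>a<n. \<Sum>b<n. y $ a * (X $$ (a, b) * y $ b))"
    if "X \<in> carrier_mat n n" for X
    using that y by (auto simp: scalar_prod_def sum_distrib_left atLeast0LessThan)
  have "y \<bullet> (mode_average n N lam P i *\<^sub>v y) =
      (\<Sum>a<n. \<Sum>b<n. \<Sum>j=1..N. lam i j * (y $ a * (P j $$ (a, b) * y $ b)))"
    unfolding q[OF mode_average_carrier]
    by (intro sum.cong refl) (simp add: mode_average_def sum_distrib_left sum_distrib_right ac_simps)
  also have "\<dots> = (\<Sum>a<n. \<Sum>j=1..N. \<Sum>b<n. lam i j * (y $ a * (P j $$ (a, b) * y $ b)))"
    by (intro sum.cong refl sum.swap)
  also have "\<dots> = (\<Sum>j=1..N. \<Sum>a<n. \<Sum>b<n. lam i j * (y $ a * (P j $$ (a, b) * y $ b)))"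
    by (rule sum.swap)
  also have "\<dots> = (\<Sum>j=1..N. lam i j * (y \<bullet> (P j *\<^sub>v y)))"
    using q[OF P] by (intro sum.cong refl) (simp add: sum_distrib_left)
  finally show ?thesis .
qed

lemma quadratic_form_transpose_mult:
  fixes X Y :: "real mat"
  assumes X: "X \<in> carrier_mat n n" and Y: "Y \<in> carrier_mat n n" and x: "x \<in> carrier_vec n"
  shows "x \<bullet> ((transpose_mat X * Y * X) *\<^sub>v x) = (X *\<^sub>v x) \<bullet> (Y *\<^sub>v (X *\<^sub>v x))"
proof -
  have Xt: "transpose_mat X \<in> carrier_mat n n" and Xx: "X *\<^sub>v x \<in> carrier_vec n"
    using X x by auto
  have YXx: "Y *\<^sub>v (X *\<^sub>v x) \<in> carrier_vec n"
    using Y Xx by simp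
  have "(transpose_mat X * Y * X) *\<^sub>v x = transpose_mat X *\<^sub>v (Y *\<^sub>v (X *\<^sub>v x))"
    using assoc_mult_mat_vec[OF mult_carrier_mat[OF Xt Y] X x] assoc_mult_mat_vec[OF Xt Y Xx] by simp
  then have "x \<bullet> ((transpose_mat X * Y * X) *\<^sub>v x) = (transpose_mat X *\<^sub>v (Y *\<^sub>v (X *\<^sub>v x))) \<bullet> x"
    using Xt YXx x by (simp add: comm_scalar_prod[of x n])
  also have "\<dots> = (Y *\<^sub>v (X *\<^sub>v x)) \<bullet> (X *\<^sub>v x)"
    by (rule transpose_vec_mult_scalar[OF X x YXx])
  also have "\<dots> = (X *\<^sub>v x) \<bullet> (Y *\<^sub>v (X *\<^sub>v x))"
    by (rule comm_scalar_prod[OF YXx Xx])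
  finally show ?thesis .
qed

text \<open>\<open>A x\<close> and \<open>C x\<close> are killed by \<open>transpose_mat F\<close>,
  so \<open>S + F * Q * transpose_mat F\<close> acts on them as \<open>S\<close>.\<close>

lemma lyapunov_form:
  fixes A C E F Q P S :: "real mat"
  assumes S: "S \<in> carrier_mat n n" and F: "F \<in> carrier_mat n m" and Q: "Q \<in> carrier_mat m m"
    and A: "A \<in> carrier_mat n n" and C: "C \<in> carrier_mat n n"
    and E: "E \<in> carrier_mat n n" and P: "P \<in> carrier_mat n n" and x: "x \<in> carrier_vec n"
    and FA: "transpose_mat F *\<^sub>v (A *\<^sub>v x) = 0\<^sub>v m" and FC: "transpose_mat F *\<^sub>v (C *\<^sub>v x) = 0\<^sub>v m"
  shows "x \<bullet> ((transpose_mat A * (S + F * Q * transpose_mat F) * A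
        + transpose_mat C * (S + F * Q * transpose_mat F) * C - transpose_mat E * P * E) *\<^sub>v x) =
      (A *\<^sub>v x) \<bullet> (S *\<^sub>v (A *\<^sub>v x)) + (C *\<^sub>v x) \<bullet> (S *\<^sub>v (C *\<^sub>v x)) - (E *\<^sub>v x) \<bullet> (P *\<^sub>v (E *\<^sub>v x))"
proof -
  let ?T = "S + F * Q * transpose_mat F"
  let ?XA = "transpose_mat A * ?T * A" and ?XC = "transpose_mat C * ?T * C"
    and ?XE = "transpose_mat E * P * E"
  have FQ: "F * Q \<in> carrier_mat n m" and Ft: "transpose_mat F \<in> carrier_mat m n"
    using F Q by auto
  then have FQF: "F * Q * transpose_mat F \<in> carrier_mat n n"
    by (rule mult_carrier_mat)
  then have T: "?T \<in> carrier_mat n n"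
    using S by simp
  have Ty: "?T *\<^sub>v y = S *\<^sub>v y" if y: "y \<in> carrier_vec n" "transpose_mat F *\<^sub>v y = 0\<^sub>v m" for y
    using add_mult_distrib_mat_vec[OF S FQF y(1)] assoc_mult_mat_vec[OF FQ Ft y(1)] y(2)
      mult_mat_zero_vec[OF FQ] mult_mat_vec_carrier[OF S y(1)] by simp
  have XA: "?XA \<in> carrier_mat n n" and XC: "?XC \<in> carrier_mat n n" and XE: "?XE \<in> carrier_mat n n"
    using A C E T P by (auto intro!: mult_carrier_mat[of _ n n])
  have "(?XA + ?XC - ?XE) *\<^sub>v x = ?XA *\<^sub>v x + ?XC *\<^sub>v x - ?XE *\<^sub>v x"
    using minus_mult_distrib_mat_vec[OF add_carrier_mat[OF XC, of ?XA] XE x]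
      add_mult_distrib_mat_vec[OF XA XC x] by simp
  then have "x \<bullet> ((?XA + ?XC - ?XE) *\<^sub>v x) =
      x \<bullet> (?XA *\<^sub>v x) + x \<bullet> (?XC *\<^sub>v x) - x \<bullet> (?XE *\<^sub>v x)"
    using mult_mat_vec_carrier[OF XA x] mult_mat_vec_carrier[OF XC x] mult_mat_vec_carrier[OF XE x] x
      scalar_prod_minus_distrib[of x n "?XA *\<^sub>v x + ?XC *\<^sub>v x" "?XE *\<^sub>v x"]
      scalar_prod_add_distrib[of x n "?XA *\<^sub>v x" "?XC *\<^sub>v x"] by simp
  then show ?thesis
    unfolding quadratic_form_transpose_mult[OF A T x] quadratic_form_transpose_mult[OF C T x]
      quadratic_form_transpose_mult[OF E P x]
    using Ty[OF mult_mat_vec_carrier[OF A x] FA] Ty[OF mult_mat_vec_carrier[OF C x] FC] by simp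
qed

section \<open>Square-integrable vectors and conditional noise\<close>

lemma integrable_mult_of_squares:
  fixes f g :: "'a \<Rightarrow> real"
  assumes [measurable]: "f \<in> borel_measurable M" "g \<in> borel_measurable M"
    and "integrable M (\<lambda>x. (f x)\<^sup>2)" "integrable M (\<lambda>x. (g x)\<^sup>2)"
  shows "integrable M (\<lambda>x. f x * g x)"
proof (rule Bochner_Integration.integrable_bound)
  show "integrable M (\<lambda>x. (f x)\<^sup>2 + (g x)\<^sup>2)"
    using assms by simp
  have "\<bar>s * t\<bar> \<le> s\<^sup>2 + t\<^sup>2" for s t :: real
  proof -
    have "2 * \<bar>s * t\<bar> \<le> s\<^sup>2 + t\<^sup>2"
      using sum_squares_bound[of "\<bar>s\<bar>" "\<bar>t\<bar>"] by (simp add: abs_mult mult.assoc)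
    then show ?thesis
      using abs_ge_zero[of "s * t"] by linarith
  qed
  then show "AE x in M. norm (f x * g x) \<le> norm ((f x)\<^sup>2 + (g x)\<^sup>2)"
    by simp
qed simp

lemma integrable_square_add:
  fixes f g :: "'a \<Rightarrow> real"
  assumes "f \<in> borel_measurable M" "g \<in> borel_measurable M"
    and "integrable M (\<lambda>x. (f x)\<^sup>2)" "integrable M (\<lambda>x. (g x)\<^sup>2)"
  shows "integrable M (\<lambda>x. (f x + g x)\<^sup>2)"
proof -
  have "integrable M (\<lambda>x. (f x)\<^sup>2 + (g x)\<^sup>2 + 2 * (f x * g x))"
    using integrable_mult_of_squares[OF assms] assms(3,4) by simp
  then show ?thesis
    by (simp only: power2_sum mult.assoc)
qed

lemma integrable_square_sum:
  fixes f :: "'i \<Rightarrow> 'a \<Rightarrow> real"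
  assumes "finite I" "\<And>i. i \<in> I \<Longrightarrow> f i \<in> borel_measurable M"
    and "\<And>i. i \<in> I \<Longrightarrow> integrable M (\<lambda>x. (f i x)\<^sup>2)"
  shows "integrable M (\<lambda>x. (\<Sum>i\<in>I. f i x)\<^sup>2)"
  using assms
proof (induction I rule: finite_induct)
  case (insert i I)
  then have "integrable M (\<lambda>x. (f i x + (\<Sum>i\<in>I. f i x))\<^sup>2)"
    by (intro integrable_square_add borel_measurable_sum) auto
  then show ?case
    using insert by simp
qed simp

lemma integrable_square_mult_bounded:
  fixes c f :: "'a \<Rightarrow> real"
  assumes [measurable]: "c \<in> borel_measurable M" "f \<in> borel_measurable M"
    and "integrable M (\<lambda>x. (f x)\<^sup>2)" and bound: "\<And>x. x \<in> space M \<Longrightarrow> \<bar>c x\<bar> \<le> b"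
  shows "integrable M (\<lambda>x. (c x * f x)\<^sup>2)"
proof (rule Bochner_Integration.integrable_bound)
  show "integrable M (\<lambda>x. b\<^sup>2 * (f x)\<^sup>2)"
    using assms by simp
  have "(c x)\<^sup>2 \<le> b\<^sup>2" if "x \<in> space M" for x
    using power_mono[OF bound[OF that], of 2] by simp
  then show "AE x in M. norm ((c x * f x)\<^sup>2) \<le> norm (b\<^sup>2 * (f x)\<^sup>2)"
    by (auto simp: power_mult_distrib intro!: AE_I2 mult_right_mono)
qed simp

section \<open>Integrals of products with conditionally centred noise and with a random mode\<close>

context sigma_finite_subalgebra
begin

text \<open>The real conditional expectation is a difference of \<open>enn2real\<close> values, and
  \<open>enn2real\<close> sends infinity to 0. The value 1 thus excludes an infinite conditional
  second moment; the negative part of a square contributes 0.\<close>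

lemma nn_cond_exp_square_eq_1:
  fixes u :: "'a \<Rightarrow> real"
  assumes "AE x in M. real_cond_exp M F (\<lambda>x. (u x)\<^sup>2) x = 1"
  shows "AE x in M. nn_cond_exp M F (\<lambda>x. ennreal ((u x)\<^sup>2)) x = 1"
proof -
  have "AE x in M. 0 = nn_cond_exp M F (\<lambda>x. 0) x"
    by (rule nn_cond_exp_F_meas) simp
  with assms show ?thesis
  proof eventually_elim
    case (elim x)
    have "(\<lambda>x. ennreal (- ((u x)\<^sup>2))) = (\<lambda>x. 0)"
      by (auto simp: ennreal_neg)
    then have "enn2real (nn_cond_exp M F (\<lambda>x. ennreal ((u x)\<^sup>2)) x) = 1"
      using elim by (simp add: real_cond_exp_def)
    then show ?case
      by (cases "nn_cond_exp M F (\<lambda>x. ennreal ((u x)\<^sup>2)) x") (auto simp flip: ennreal_1)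
  qed
qed

text \<open>Conditioning on \<open>F\<close> replaces \<open>u^2\<close> by 1 and leaves the second
  moment of \<open>b\<close>. The computation is done with nonnegative integrals because
  integrability is the claim itself.\<close>

lemma integrable_square_noise_mult:
  fixes u b :: "'a \<Rightarrow> real"
  assumes u [measurable]: "u \<in> borel_measurable M"
    and var: "AE x in M. real_cond_exp M F (\<lambda>x. (u x)\<^sup>2) x = 1"
    and b [measurable]: "b \<in> borel_measurable F" and b2: "integrable M (\<lambda>x. (b x)\<^sup>2)"
  shows "integrable M (\<lambda>x. (u x * b x)\<^sup>2)"
proof -
  have [measurable]: "b \<in> borel_measurable M"
    using measurable_from_subalg[OF subalg b] .
  have "(\<integral>\<^sup>+x. ennreal ((u x * b x)\<^sup>2) \<partial>M) = (\<integral>\<^sup>+x. ennreal ((b x)\<^sup>2) * ennreal ((u x)\<^sup>2) \<partial>M)"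
    by (simp add: ennreal_mult' power_mult_distrib mult.commute)
  also have "\<dots> = (\<integral>\<^sup>+x. ennreal ((b x)\<^sup>2) * nn_cond_exp M F (\<lambda>x. ennreal ((u x)\<^sup>2)) x \<partial>M)"
    by (rule nn_cond_exp_intg[symmetric]) measurable
  also have "\<dots> = (\<integral>\<^sup>+x. ennreal ((b x)\<^sup>2) \<partial>M)"
    using nn_cond_exp_square_eq_1[OF var] by (intro nn_integral_cong_AE) auto
  also have "\<dots> < \<infinity>"
    using b2 by (simp add: integrable_iff_bounded)
  finally show ?thesis
    by (simp add: integrable_iff_bounded)
qed

text \<open>In the expanded product the mixed terms vanish by the conditional mean, and the term
  with \<open>u^2\<close> loses that factor by the conditional variance. Two coefficient pairs are
  needed because the second factor will be the image of the first under the averaged matrix.\<close>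

lemma
  fixes u a b a' b' :: "'a \<Rightarrow> real"
  assumes u [measurable]: "u \<in> borel_measurable M"
    and mean: "AE x in M. real_cond_exp M F u x = 0"
    and var: "AE x in M. real_cond_exp M F (\<lambda>x. (u x)\<^sup>2) x = 1"
    and meas [measurable]: "a \<in> borel_measurable F" "b \<in> borel_measurable F"
      "a' \<in> borel_measurable F" "b' \<in> borel_measurable F"
    and sq: "integrable M (\<lambda>x. (a x)\<^sup>2)" "integrable M (\<lambda>x. (b x)\<^sup>2)"
      "integrable M (\<lambda>x. (a' x)\<^sup>2)" "integrable M (\<lambda>x. (b' x)\<^sup>2)"
  shows integrable_noise_product: "integrable M (\<lambda>x. (a x + u x * b x) * (a' x + u x * b' x))"
    and integral_noise_product: "(\<integral>x. (a x + u x * b x) * (a' x + u x * b' x) \<partial>M) =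
      (\<integral>x. a x * a' x \<partial>M) + (\<integral>x. b x * b' x \<partial>M)"
proof -
  note [measurable] = meas[THEN measurable_from_subalg[OF subalg]]
  note ub = integrable_square_noise_mult[OF u var]
  have i1: "integrable M (\<lambda>x. a x * a' x)"
    using sq by (intro integrable_mult_of_squares) auto
  have i2: "integrable M (\<lambda>x. a x * (u x * b' x))" "integrable M (\<lambda>x. (u x * b x) * a' x)"
    using sq ub by (auto intro!: integrable_mult_of_squares)
  have i3: "integrable M (\<lambda>x. (u x * b x) * (u x * b' x))"
    using sq ub by (intro integrable_mult_of_squares) auto
  have zero: "(\<integral>x. f x * u x \<partial>M) = 0"
    if "integrable M (\<lambda>x. f x * u x)" "f \<in> borel_measurable F" for f
  proof -
    have "(\<integral>x. f x * u x \<partial>M) = (\<integral>x. f x * real_cond_exp M F u x \<partial>M)"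
      using real_cond_exp_intg(2)[OF that u] by simp
    also have "\<dots> = (\<integral>x. 0 \<partial>M)"
      using mean that measurable_from_subalg[OF subalg that(2)] by (intro integral_cong_AE) auto
    finally show ?thesis by simp
  qed
  have z1: "(\<integral>x. a x * (u x * b' x) \<partial>M) = 0"
    using zero[of "\<lambda>x. a x * b' x"] i2 by (simp add: ac_simps)
  have z2: "(\<integral>x. (u x * b x) * a' x \<partial>M) = 0"
    using zero[of "\<lambda>x. b x * a' x"] i2 by (simp add: ac_simps)
  have "(\<integral>x. (u x * b x) * (u x * b' x) \<partial>M) = (\<integral>x. (b x * b' x) * (u x)\<^sup>2 \<partial>M)"
    by (simp add: ac_simps power2_eq_square)
  also have "\<dots> = (\<integral>x. (b x * b' x) * real_cond_exp M F (\<lambda>x. (u x)\<^sup>2) x \<partial>M)"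
    using i3 by (intro real_cond_exp_intg(2)[symmetric]) (auto simp: ac_simps power2_eq_square)
  also have "\<dots> = (\<integral>x. b x * b' x \<partial>M)"
    using var by (intro integral_cong_AE) auto
  finally have z3: "(\<integral>x. (u x * b x) * (u x * b' x) \<partial>M) = (\<integral>x. b x * b' x \<partial>M)" .
  have expand: "(a x + u x * b x) * (a' x + u x * b' x) =
      a x * a' x + (a x * (u x * b' x) + ((u x * b x) * a' x + (u x * b x) * (u x * b' x)))" for x
    by (simp add: algebra_simps)
  show "integrable M (\<lambda>x. (a x + u x * b x) * (a' x + u x * b' x))"
    unfolding expand using i1 i2 i3 by (intro Bochner_Integration.integrable_add)
  show "(\<integral>x. (a x + u x * b x) * (a' x + u x * b' x) \<partial>M) =
      (\<integral>x. a x * a' x \<partial>M) + (\<integral>x. b x * b' x \<partial>M)"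
    unfolding expand using i1 i2 i3 z1 z2 z3
    by (simp add: Bochner_Integration.integral_add Bochner_Integration.integrable_add)
qed

text \<open>The integrand is split according to the value of \<open>s\<close>; each
  \<open>f j\<close> is \<open>F\<close>-measurable, so the indicator of \<open>s = j\<close> may be
  replaced by its conditional expectation \<open>p x j\<close>.\<close>

lemma integral_mode_switch:
  fixes s :: "'a \<Rightarrow> nat" and f :: "nat \<Rightarrow> 'a \<Rightarrow> real" and p :: "'a \<Rightarrow> nat \<Rightarrow> real"
  assumes s: "s \<in> measurable M (count_space UNIV)" and range: "\<And>x. x \<in> space M \<Longrightarrow> s x \<in> J"
    and fin: "finite J"
    and law: "\<And>j. j \<in> J \<Longrightarrow> AE x in M. real_cond_exp M F (indicat_real {x \<in> space M. s x = j}) x = p x j"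
    and p: "\<And>j. j \<in> J \<Longrightarrow> (\<lambda>x. p x j) \<in> borel_measurable M"
    and meas: "\<And>j. j \<in> J \<Longrightarrow> f j \<in> borel_measurable F"
    and int: "\<And>j. j \<in> J \<Longrightarrow> integrable M (f j)"
  shows "(\<integral>x. f (s x) x \<partial>M) = (\<integral>x. (\<Sum>j\<in>J. p x j * f j x) \<partial>M)"
proof -
  let ?I = "\<lambda>j. indicat_real {x \<in> space M. s x = j}"
  have sj: "{x \<in> space M. s x = j} \<in> sets M" for j
    using measurable_sets[OF s, of "{j}"] by (simp add: vimage_def Int_def conj_commute)
  have step: "integrable M (\<lambda>x. f j x * ?I j x)" "integrable M (\<lambda>x. p x j * f j x)"
    "(\<integral>x. f j x * ?I j x \<partial>M) = (\<integral>x. p x j * f j x \<partial>M)" if j: "j \<in> J" for j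
  proof -
    show i: "integrable M (\<lambda>x. f j x * ?I j x)"
      using integrable_mult_indicator[OF sj int[OF j]] by (simp add: mult.commute)
    have I: "?I j \<in> borel_measurable M"
      using sj by simp
    note fm = measurable_from_subalg[OF subalg meas[OF j]]
    have ae: "AE x in M. f j x * real_cond_exp M F (?I j) x = p x j * f j x"
      using law[OF j] by eventually_elim simp
    note r = real_cond_exp_intg[OF i meas[OF j] I]
    \<comment> \<open>Integrability is transferred from the product with the conditional
      expectation, so no bound on \<open>p\<close> is required.\<close>
    show "integrable M (\<lambda>x. p x j * f j x)"
      using r(1) ae fm p[OF j] by (subst integrable_cong_AE[symmetric, OF _ _ ae]) auto
    show "(\<integral>x. f j x * ?I j x \<partial>M) = (\<integral>x. p x j * f j x \<partial>M)"
      unfolding r(2)[symmetric] using fm p[OF j] by (intro integral_cong_AE[OF _ _ ae]) auto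
  qed
  have "(\<integral>x. f (s x) x \<partial>M) = (\<integral>x. (\<Sum>j\<in>J. f j x * ?I j x) \<partial>M)"
  proof (rule Bochner_Integration.integral_cong[OF refl])
    fix x assume x: "x \<in> space M"
    have "(\<Sum>j\<in>J. f j x * ?I j x) = (\<Sum>j\<in>J. if j = s x then f j x else 0)"
      using x by (intro sum.cong) (auto simp: indicator_def)
    then show "f (s x) x = (\<Sum>j\<in>J. f j x * ?I j x)"
      using range[OF x] fin by simp
  qed
  also have "\<dots> = (\<integral>x. (\<Sum>j\<in>J. p x j * f j x) \<partial>M)"
    using step by simp
  finally show ?thesis .
qed

end

text \<open>Two measures are kept apart: integrals are taken in \<open>M\<close>, measurability is
  with respect to the subalgebra \<open>F\<close>. This is adaptedness together with square
  integrability.\<close>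

definition L2_vec :: "'a measure \<Rightarrow> 'a measure \<Rightarrow> nat \<Rightarrow> ('a \<Rightarrow> real vec) \<Rightarrow> bool" where
  "L2_vec M F n z \<longleftrightarrow> (\<forall>\<omega>\<in>space M. z \<omega> \<in> carrier_vec n) \<and>
     (\<forall>j<n. (\<lambda>\<omega>. z \<omega> $ j) \<in> borel_measurable F \<and> integrable M (\<lambda>\<omega>. (z \<omega> $ j)\<^sup>2))"

lemma L2_vec_const:
  assumes "finite_measure M" "v \<in> carrier_vec n"
  shows "L2_vec M F n (\<lambda>_. v)"
  using assms by (auto simp: L2_vec_def finite_measure.integrable_const)

lemma L2_vec_mono:
  assumes "subalgebra F' F" "L2_vec M F n z"
  shows "L2_vec M F' n z"
  using assms measurable_from_subalg[OF assms(1)] by (auto simp: L2_vec_def)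

lemma L2_vec_mode_mult:
  assumes sub: "subalgebra M F" and z: "L2_vec M F q z"
    and s: "s \<in> measurable F (count_space UNIV)" and range: "\<And>\<omega>. \<omega> \<in> space M \<Longrightarrow> s \<omega> \<in> J"
    and fin: "finite J" and X: "\<And>j. j \<in> J \<Longrightarrow> X j \<in> carrier_mat p q"
  shows "L2_vec M F p (\<lambda>\<omega>. X (s \<omega>) *\<^sub>v z \<omega>)"
  unfolding L2_vec_def
proof (intro conjI ballI allI impI)
  fix \<omega> assume "\<omega> \<in> space M"
  then show "X (s \<omega>) *\<^sub>v z \<omega> \<in> carrier_vec p"
    using z by (auto simp: L2_vec_def intro!: mult_mat_vec_carrier X range)
next
  fix j assume j: "j < p"
  let ?g = "\<lambda>\<omega>. \<Sum>l<q. X (s \<omega>) $$ (j, l) * z \<omega> $ l"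
  have eq: "(X (s \<omega>) *\<^sub>v z \<omega>) $ j = ?g \<omega>" if "\<omega> \<in> space M" for \<omega>
  proof -
    have "X (s \<omega>) \<in> carrier_mat p q" "z \<omega> \<in> carrier_vec q"
      using X[OF range[OF that]] z that by (auto simp: L2_vec_def)
    then show ?thesis
      using j by (auto simp: scalar_prod_def atLeast0LessThan)
  qed
  have space: "space F = space M"
    using sub by (simp add: subalgebra_def)
  have c: "(\<lambda>\<omega>. X (s \<omega>) $$ (j, l)) \<in> borel_measurable F" for l
    using measurable_compose[OF s, of "\<lambda>i. X i $$ (j, l)" borel] by simp
  have zl: "(\<lambda>\<omega>. z \<omega> $ l) \<in> borel_measurable F" "integrable M (\<lambda>\<omega>. (z \<omega> $ l)\<^sup>2)" if "l < q" for l
    using z that by (auto simp: L2_vec_def)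
  have "?g \<in> borel_measurable F"
    using c zl by (intro borel_measurable_sum borel_measurable_times) auto
  then show "(\<lambda>\<omega>. (X (s \<omega>) *\<^sub>v z \<omega>) $ j) \<in> borel_measurable F"
    using eq by (subst measurable_cong[of F _ ?g]) (auto simp: space)
  have "integrable M (\<lambda>\<omega>. (?g \<omega>)\<^sup>2)"
  proof (rule integrable_square_sum)
    fix l assume "l \<in> {..<q}"
    then have l: "l < q" by simp
    note meas = measurable_from_subalg[OF sub c[of l]] measurable_from_subalg[OF sub zl(1)[OF l]]
    show "(\<lambda>\<omega>. X (s \<omega>) $$ (j, l) * z \<omega> $ l) \<in> borel_measurable M"
      using meas by simp
    show "integrable M (\<lambda>\<omega>. (X (s \<omega>) $$ (j, l) * z \<omega> $ l)\<^sup>2)"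
    proof (rule integrable_square_mult_bounded[OF meas zl(2)[OF l]])
      fix \<omega> assume "\<omega> \<in> space M"
      \<comment> \<open>Only finitely many modes occur, so the sum over all of them bounds the entry
        for the random one.\<close>
      then show "\<bar>X (s \<omega>) $$ (j, l)\<bar> \<le> (\<Sum>i\<in>J. \<bar>X i $$ (j, l)\<bar>)"
        using fin range by (intro member_le_sum) auto
    qed
  qed simp
  then show "integrable M (\<lambda>\<omega>. ((X (s \<omega>) *\<^sub>v z \<omega>) $ j)\<^sup>2)"
    by (rule iffD1[OF Bochner_Integration.integrable_cong, rotated 2]) (auto simp: eq)
qed

lemma L2_vec_add:
  assumes sub: "subalgebra M F" and a: "L2_vec M F n a" and b: "L2_vec M F n b"
  shows "L2_vec M F n (\<lambda>\<omega>. a \<omega> + b \<omega>)"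
  unfolding L2_vec_def
proof (intro conjI ballI allI impI)
  fix \<omega> assume "\<omega> \<in> space M"
  then show "a \<omega> + b \<omega> \<in> carrier_vec n"
    using a b by (auto simp: L2_vec_def)
next
  fix j assume j: "j < n"
  have eq: "(a \<omega> + b \<omega>) $ j = a \<omega> $ j + b \<omega> $ j" if "\<omega> \<in> space M" for \<omega>
    using j b that by (auto simp: L2_vec_def)
  have m: "(\<lambda>\<omega>. a \<omega> $ j) \<in> borel_measurable F" "(\<lambda>\<omega>. b \<omega> $ j) \<in> borel_measurable F"
    "integrable M (\<lambda>\<omega>. (a \<omega> $ j)\<^sup>2)" "integrable M (\<lambda>\<omega>. (b \<omega> $ j)\<^sup>2)"
    using a b j by (auto simp: L2_vec_def)
  have space: "space F = space M"
    using sub by (simp add: subalgebra_def)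
  show "(\<lambda>\<omega>. (a \<omega> + b \<omega>) $ j) \<in> borel_measurable F"
    using borel_measurable_add[OF m(1,2)]
    by (subst measurable_cong[of F _ "\<lambda>\<omega>. a \<omega> $ j + b \<omega> $ j"]) (auto simp: space eq)
  have "integrable M (\<lambda>\<omega>. (a \<omega> $ j + b \<omega> $ j)\<^sup>2)"
    using m by (intro integrable_square_add measurable_from_subalg[OF sub])
  then show "integrable M (\<lambda>\<omega>. ((a \<omega> + b \<omega>) $ j)\<^sup>2)"
    by (rule iffD1[OF Bochner_Integration.integrable_cong, rotated 2]) (auto simp: eq)
qed

lemma L2_vec_scalar_prod:
  assumes sub: "subalgebra M F" and y: "L2_vec M F n y" and z: "L2_vec M F n z"
  shows "(\<lambda>\<omega>. y \<omega> \<bullet> z \<omega>) \<in> borel_measurable F" "integrable M (\<lambda>\<omega>. y \<omega> \<bullet> z \<omega>)"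
    "(\<integral>\<omega>. y \<omega> \<bullet> z \<omega> \<partial>M) = (\<Sum>j<n. \<integral>\<omega>. y \<omega> $ j * z \<omega> $ j \<partial>M)"
proof -
  have eq: "y \<omega> \<bullet> z \<omega> = (\<Sum>j<n. y \<omega> $ j * z \<omega> $ j)" if "\<omega> \<in> space M" for \<omega>
    using z that by (auto simp: L2_vec_def scalar_prod_def atLeast0LessThan)
  have m: "(\<lambda>\<omega>. y \<omega> $ j) \<in> borel_measurable F" "(\<lambda>\<omega>. z \<omega> $ j) \<in> borel_measurable F"
    "integrable M (\<lambda>\<omega>. (y \<omega> $ j)\<^sup>2)" "integrable M (\<lambda>\<omega>. (z \<omega> $ j)\<^sup>2)" if "j < n" for j
    using y z that by (auto simp: L2_vec_def)
  have i: "integrable M (\<lambda>\<omega>. y \<omega> $ j * z \<omega> $ j)" if "j < n" for j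
    using m[OF that] measurable_from_subalg[OF sub] by (intro integrable_mult_of_squares) auto
  have space: "space F = space M"
    using sub by (simp add: subalgebra_def)
  have "(\<lambda>\<omega>. \<Sum>j<n. y \<omega> $ j * z \<omega> $ j) \<in> borel_measurable F"
    using m by (intro borel_measurable_sum borel_measurable_times) auto
  then show "(\<lambda>\<omega>. y \<omega> \<bullet> z \<omega>) \<in> borel_measurable F"
    using eq by (subst measurable_cong[of F _ "\<lambda>\<omega>. \<Sum>j<n. y \<omega> $ j * z \<omega> $ j"]) (auto simp: space)
  have "integrable M (\<lambda>\<omega>. \<Sum>j<n. y \<omega> $ j * z \<omega> $ j)"
    using i by (intro Bochner_Integration.integrable_sum) auto
  then show "integrable M (\<lambda>\<omega>. y \<omega> \<bullet> z \<omega>)"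
    by (rule iffD1[OF Bochner_Integration.integrable_cong, rotated 2]) (auto simp: eq)
  have "(\<integral>\<omega>. y \<omega> \<bullet> z \<omega> \<partial>M) = (\<integral>\<omega>. (\<Sum>j<n. y \<omega> $ j * z \<omega> $ j) \<partial>M)"
    by (rule Bochner_Integration.integral_cong) (auto simp: eq)
  also have "\<dots> = (\<Sum>j<n. \<integral>\<omega>. y \<omega> $ j * z \<omega> $ j \<partial>M)"
    using i by (intro Bochner_Integration.integral_sum) auto
  finally show "(\<integral>\<omega>. y \<omega> \<bullet> z \<omega> \<partial>M) = (\<Sum>j<n. \<integral>\<omega>. y \<omega> $ j * z \<omega> $ j \<partial>M)" .
qed

context sigma_finite_subalgebra
begin

text \<open>The product is only measurable for the larger algebra \<open>F'\<close>, which knows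
  \<open>u\<close>, while its second moment is computed by conditioning on \<open>F\<close>, which
  does not have to.\<close>

lemma L2_vec_noise_mult:
  assumes sub: "subalgebra M F'" "subalgebra F' F"
    and u: "u \<in> borel_measurable F'"
    and var: "AE \<omega> in M. real_cond_exp M F (\<lambda>\<omega>. (u \<omega>)\<^sup>2) \<omega> = 1"
    and b: "L2_vec M F n b"
  shows "L2_vec M F' n (\<lambda>\<omega>. u \<omega> \<cdot>\<^sub>v b \<omega>)"
  unfolding L2_vec_def
proof (intro conjI ballI allI impI)
  fix \<omega> assume "\<omega> \<in> space M"
  then show "u \<omega> \<cdot>\<^sub>v b \<omega> \<in> carrier_vec n"
    using b by (auto simp: L2_vec_def)
next
  fix j assume j: "j < n"
  have eq: "(u \<omega> \<cdot>\<^sub>v b \<omega>) $ j = u \<omega> * b \<omega> $ j" if "\<omega> \<in> space M" for \<omega>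
    using j b that by (auto simp: L2_vec_def)
  have m: "(\<lambda>\<omega>. b \<omega> $ j) \<in> borel_measurable F" "integrable M (\<lambda>\<omega>. (b \<omega> $ j)\<^sup>2)"
    using b j by (auto simp: L2_vec_def)
  have space: "space F' = space M"
    using sub by (simp add: subalgebra_def)
  show "(\<lambda>\<omega>. (u \<omega> \<cdot>\<^sub>v b \<omega>) $ j) \<in> borel_measurable F'"
    using borel_measurable_times[OF u measurable_from_subalg[OF sub(2) m(1)]]
    by (subst measurable_cong[of F' _ "\<lambda>\<omega>. u \<omega> * b \<omega> $ j"]) (auto simp: space eq)
  have "integrable M (\<lambda>\<omega>. (u \<omega> * b \<omega> $ j)\<^sup>2)"
    using integrable_square_noise_mult[OF measurable_from_subalg[OF sub(1) u] var m] .
  then show "integrable M (\<lambda>\<omega>. ((u \<omega> \<cdot>\<^sub>v b \<omega>) $ j)\<^sup>2)"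
    by (rule iffD1[OF Bochner_Integration.integrable_cong, rotated 2]) (auto simp: eq)
qed

lemma integral_noise_scalar_prod:
  assumes u: "u \<in> borel_measurable M"
    and mean: "AE \<omega> in M. real_cond_exp M F u \<omega> = 0"
    and var: "AE \<omega> in M. real_cond_exp M F (\<lambda>\<omega>. (u \<omega>)\<^sup>2) \<omega> = 1"
    and L2: "L2_vec M F n a" "L2_vec M F n b" "L2_vec M F n a'" "L2_vec M F n b'"
  shows "(\<integral>\<omega>. (a \<omega> + u \<omega> \<cdot>\<^sub>v b \<omega>) \<bullet> (a' \<omega> + u \<omega> \<cdot>\<^sub>v b' \<omega>) \<partial>M) =
    (\<integral>\<omega>. a \<omega> \<bullet> a' \<omega> \<partial>M) + (\<integral>\<omega>. b \<omega> \<bullet> b' \<omega> \<partial>M)"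
proof -
  have m: "(\<lambda>\<omega>. a \<omega> $ j) \<in> borel_measurable F" "(\<lambda>\<omega>. b \<omega> $ j) \<in> borel_measurable F"
      "(\<lambda>\<omega>. a' \<omega> $ j) \<in> borel_measurable F" "(\<lambda>\<omega>. b' \<omega> $ j) \<in> borel_measurable F"
    and i: "integrable M (\<lambda>\<omega>. (a \<omega> $ j)\<^sup>2)" "integrable M (\<lambda>\<omega>. (b \<omega> $ j)\<^sup>2)"
      "integrable M (\<lambda>\<omega>. (a' \<omega> $ j)\<^sup>2)" "integrable M (\<lambda>\<omega>. (b' \<omega> $ j)\<^sup>2)" if "j < n" for j
    using L2 that by (auto simp: L2_vec_def)
  note np = integrable_noise_product[OF u mean var m i] integral_noise_product[OF u mean var m i]
  let ?t = "\<lambda>j \<omega>. (a \<omega> $ j + u \<omega> * b \<omega> $ j) * (a' \<omega> $ j + u \<omega> * b' \<omega> $ j)"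
  have "(\<integral>\<omega>. (a \<omega> + u \<omega> \<cdot>\<^sub>v b \<omega>) \<bullet> (a' \<omega> + u \<omega> \<cdot>\<^sub>v b' \<omega>) \<partial>M) = (\<integral>\<omega>. (\<Sum>j<n. ?t j \<omega>) \<partial>M)"
  proof (rule Bochner_Integration.integral_cong[OF refl])
    fix \<omega> assume "\<omega> \<in> space M"
    then have "a \<omega> \<in> carrier_vec n" "b \<omega> \<in> carrier_vec n" "a' \<omega> \<in> carrier_vec n" "b' \<omega> \<in> carrier_vec n"
      using L2 by (auto simp: L2_vec_def)
    then show "(a \<omega> + u \<omega> \<cdot>\<^sub>v b \<omega>) \<bullet> (a' \<omega> + u \<omega> \<cdot>\<^sub>v b' \<omega>) = (\<Sum>j<n. ?t j \<omega>)"
      by (auto simp: scalar_prod_def atLeast0LessThan)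
  qed
  also have "\<dots> = (\<Sum>j<n. \<integral>\<omega>. ?t j \<omega> \<partial>M)"
    using np(1) by (intro Bochner_Integration.integral_sum) auto
  also have "\<dots> = (\<Sum>j<n. (\<integral>\<omega>. a \<omega> $ j * a' \<omega> $ j \<partial>M) + (\<integral>\<omega>. b \<omega> $ j * b' \<omega> $ j \<partial>M))"
    using np(2) by (intro sum.cong) auto
  also have "\<dots> = (\<integral>\<omega>. a \<omega> \<bullet> a' \<omega> \<partial>M) + (\<integral>\<omega>. b \<omega> \<bullet> b' \<omega> \<partial>M)"
    using L2_vec_scalar_prod(3)[OF subalg L2(1,3)] L2_vec_scalar_prod(3)[OF subalg L2(2,4)]
    by (simp add: sum.distrib)
  finally show ?thesis .
qed

end

section \<open>Histories\<close>

lemma history_generators: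
  "{r i -` B \<inter> space M |i B. i \<le> k} \<union> {w i -` B \<inter> space M |i B. i < l \<and> B \<in> sets borel} \<subseteq> Pow (space M)"
  by auto

lemma space_history [simp]: "space (history M r w k l) = space M"
  by (simp add: history_def space_measure_of_conv)

lemma sets_history:
  "sets (history M r w k l) = sigma_sets (space M)
    ({r i -` B \<inter> space M |i B. i \<le> k} \<union> {w i -` B \<inter> space M |i B. i < l \<and> B \<in> sets borel})"
  unfolding history_def by (rule sets_measure_of[OF history_generators])

lemma subalgebra_history:
  assumes "\<And>i. r i \<in> measurable M (count_space UNIV)" "\<And>i. w i \<in> borel_measurable M"
  shows "subalgebra M (history M r w k l)"
proof -
  have "r i -` B \<inter> space M \<in> sets M" for i B
    using measurable_sets[OF assms(1)] by simp
  moreover have "w i -` B \<inter> space M \<in> sets M" if "B \<in> sets borel" for i B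
    using measurable_sets[OF assms(2) that] .
  ultimately have "{r i -` B \<inter> space M |i B. i \<le> k} \<union>
      {w i -` B \<inter> space M |i B. i < l \<and> B \<in> sets borel} \<subseteq> sets M"
    by blast
  then show ?thesis
    unfolding subalgebra_def sets_history by (simp add: sets.sigma_sets_subset)
qed

lemma subalgebra_history_mono:
  assumes "k \<le> k'" "l \<le> l'"
  shows "subalgebra (history M r w k' l') (history M r w k l)"
proof -
  have "i \<le> k'" if "i \<le> k" for i
    using that assms by simp
  moreover have "i < l'" if "i < l" for i
    using that assms by simp
  ultimately have "sets (history M r w k l) \<subseteq> sets (history M r w k' l')"
    unfolding sets_history by (intro sigma_sets_subseteq Un_mono Collect_mono) metis+
  then show ?thesis
    by (simp add: subalgebra_def)
qed

lemma measurable_history_mode: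
  assumes "i \<le> k"
  shows "r i \<in> measurable (history M r w k l) (count_space UNIV)"
proof (rule measurableI)
  fix B :: "nat set"
  show "r i -` B \<inter> space (history M r w k l) \<in> sets (history M r w k l)"
    unfolding space_history sets_history
    using assms by (intro sigma_sets.Basic) blast
qed simp

lemma measurable_history_noise:
  assumes "i < l"
  shows "w i \<in> borel_measurable (history M r w k l)"
proof (rule measurableI)
  fix B :: "real set" assume "B \<in> sets borel"
  then show "w i -` B \<inter> space (history M r w k l) \<in> sets (history M r w k l)"
    unfolding space_history sets_history
    using assms by (intro sigma_sets.Basic) blast
qed simp

section \<open>From summable second moments to conditional convergence\<close>

lemma ennreal_suminf_tendsto_0:
  fixes f :: "nat \<Rightarrow> ennreal"
  assumes "(\<Sum>k. f k) \<noteq> \<infinity>"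
  shows "f \<longlonglongrightarrow> 0"
proof -
  have fin: "f k \<noteq> \<infinity>" for k
    using assms ennreal_suminf_lessD[of f Orderings.top k] by (simp add: less_top[symmetric])
  then have eq: "f = (\<lambda>k. ennreal (enn2real (f k)))"
    by (simp add: less_top[symmetric])
  then have "summable (\<lambda>k. enn2real (f k))"
    using assms by (intro summable_suminf_not_top) auto
  then have "(\<lambda>k. ennreal (enn2real (f k))) \<longlonglongrightarrow> ennreal 0"
    by (intro tendsto_ennrealI summable_LIMSEQ_zero)
  then show ?thesis
    using eq by simp
qed

text \<open>No conditioning on particular events is needed: the conditional second moments have a
  finite sum almost everywhere because the sum of their integrals is finite.\<close>

lemma (in sigma_finite_subalgebra) nn_cond_exp_tendsto_0:
  fixes f :: "nat \<Rightarrow> 'a \<Rightarrow> real"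
  assumes f: "\<And>k. integrable M (f k)" "\<And>k \<omega>. \<omega> \<in> space M \<Longrightarrow> 0 \<le> f k \<omega>"
    and sum: "summable (\<lambda>k. \<integral>\<omega>. f k \<omega> \<partial>M)"
  shows "AE \<omega> in M. (\<lambda>k. nn_cond_exp M F (\<lambda>\<omega>. ennreal (f k \<omega>)) \<omega>) \<longlonglongrightarrow> 0"
proof -
  let ?g = "\<lambda>k. nn_cond_exp M F (\<lambda>\<omega>. ennreal (f k \<omega>))"
  have [measurable]: "f k \<in> borel_measurable M" for k
    using f by auto
  have "(\<integral>\<^sup>+\<omega>. ?g k \<omega> \<partial>M) = ennreal (\<integral>\<omega>. f k \<omega> \<partial>M)" for k
  proof -
    have "(\<integral>\<^sup>+\<omega>. ?g k \<omega> \<partial>M) = (\<integral>\<^sup>+\<omega>. ennreal (f k \<omega>) \<partial>M)"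
      using nn_cond_exp_intg[of "\<lambda>_. 1" "\<lambda>\<omega>. ennreal (f k \<omega>)"] by simp
    then show ?thesis
      using f by (simp add: nn_integral_eq_integral AE_I2)
  qed
  then have "(\<integral>\<^sup>+\<omega>. (\<Sum>k. ?g k \<omega>) \<partial>M) = (\<Sum>k. ennreal (\<integral>\<omega>. f k \<omega> \<partial>M))"
    by (simp add: nn_integral_suminf)
  also have "\<dots> \<noteq> \<infinity>"
  proof -
    have "0 \<le> (\<integral>\<omega>. f k \<omega> \<partial>M)" for k
      using f(2) by (intro Bochner_Integration.integral_nonneg_AE AE_I2)
    then show ?thesis
      unfolding infinity_ennreal_def by (rule ennreal_suminf_neq_top[OF sum])
  qed
  finally have "AE \<omega> in M. (\<Sum>k. ?g k \<omega>) \<noteq> \<infinity>"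
    by (intro nn_integral_noteq_infinite) auto
  then show ?thesis
    by eventually_elim (rule ennreal_suminf_tendsto_0)
qed

section \<open>The reduced recursion\<close>

text \<open>Collects what the matrix algebra hands over to the probabilistic part; \<open>F\<close>
  and \<open>Q\<close> no longer occur. In \<open>decay\<close>, the vector \<open>B v\<close> is
  \<open>E x\<close> for \<open>x = G(i) v\<close>, because \<open>K G(i)\<close> is the
  identity.\<close>

locale reduced_jump_system = prob_space M
  for M :: "'a measure" +
  fixes n d N :: nat and lam :: "nat \<Rightarrow> nat \<Rightarrow> real"
    and r :: "nat \<Rightarrow> 'a \<Rightarrow> nat" and w :: "nat \<Rightarrow> 'a \<Rightarrow> real"
    and E B K :: "real mat" and A C P G H H' :: "nat \<Rightarrow> real mat" and e :: real
  assumes chain: "markov_chain M N lam r"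
    and white: "wide_sense_white_noise M w"
    and compat: "noise_compatible M N lam r w"
    and carr_EBK: "E \<in> carrier_mat n n" "B \<in> carrier_mat n d" "K \<in> carrier_mat d n"
    and carr_A: "\<And>i. i \<in> {1..N} \<Longrightarrow> A i \<in> carrier_mat n n"
    and carr_C: "\<And>i. i \<in> {1..N} \<Longrightarrow> C i \<in> carrier_mat n n"
    and carr_P: "\<And>i. i \<in> {1..N} \<Longrightarrow> P i \<in> carrier_mat n n"
    and carr_G: "\<And>i. i \<in> {1..N} \<Longrightarrow> G i \<in> carrier_mat n d"
    and carr_H: "\<And>i. i \<in> {1..N} \<Longrightarrow> H i \<in> carrier_mat d d"
    and carr_H': "\<And>i. i \<in> {1..N} \<Longrightarrow> H' i \<in> carrier_mat d d"
    and EBK: "E = B * K" and injB: "injective_mat B"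
    and KG: "\<And>i. i \<in> {1..N} \<Longrightarrow> K * G i = 1\<^sub>m d"
    and AG: "\<And>i. i \<in> {1..N} \<Longrightarrow> A i * G i = B * H i"
    and CG: "\<And>i. i \<in> {1..N} \<Longrightarrow> C i * G i = B * H' i"
    and consistent: "\<And>i x y u. i \<in> {1..N} \<Longrightarrow> x \<in> carrier_vec n \<Longrightarrow> y \<in> carrier_vec n \<Longrightarrow>
      E *\<^sub>v y = A i *\<^sub>v x + u \<cdot>\<^sub>v (C i *\<^sub>v x) \<Longrightarrow> x = G i *\<^sub>v (K *\<^sub>v x)"
    and P_nonneg: "\<And>i v. i \<in> {1..N} \<Longrightarrow> v \<in> carrier_vec n \<Longrightarrow> 0 \<le> v \<bullet> (P i *\<^sub>v v)"
    and e_pos: "0 < e"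
    and decay: "\<And>i v x. i \<in> {1..N} \<Longrightarrow> v \<in> carrier_vec d \<Longrightarrow> x = G i *\<^sub>v v \<Longrightarrow>
      (A i *\<^sub>v x) \<bullet> (mode_average n N lam P i *\<^sub>v (A i *\<^sub>v x)) +
      (C i *\<^sub>v x) \<bullet> (mode_average n N lam P i *\<^sub>v (C i *\<^sub>v x)) \<le>
      (B *\<^sub>v v) \<bullet> (P i *\<^sub>v (B *\<^sub>v v)) - e * (x \<bullet> x)"
begin

abbreviation Hist :: "nat \<Rightarrow> nat \<Rightarrow> 'a measure" where
  "Hist \<equiv> history M r w"

lemma r_meas: "r k \<in> measurable M (count_space UNIV)"
  and r_range: "\<omega> \<in> space M \<Longrightarrow> r k \<omega> \<in> {1..N}"
  using chain unfolding markov_chain_def by blast+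

lemma w_meas: "w k \<in> borel_measurable M"
  using white by (auto simp: wide_sense_white_noise_def)

lemma sub_Hist: "subalgebra M (Hist k l)"
  by (rule subalgebra_history[OF r_meas w_meas])

lemma sigma_finite_Hist: "sigma_finite_subalgebra M (Hist k l)"
  by (intro finite_measure_subalgebra_is_sigma_finite finite_measure_subalgebra.intro
      finite_measure_subalgebra_axioms.intro finite_measure_axioms sub_Hist)

lemma noise_mean: "AE \<omega> in M. real_cond_exp M (Hist k k) (w k) \<omega> = 0"
  and noise_var: "AE \<omega> in M. real_cond_exp M (Hist k k) (\<lambda>\<omega>. (w k \<omega>)\<^sup>2) \<omega> = 1"
  and mode_law: "j \<in> {1..N} \<Longrightarrow> AE \<omega> in M. real_cond_exp M (Hist k (Suc k))
      (indicat_real {\<omega> \<in> space M. r (Suc k) \<omega> = j}) \<omega> = lam (r k \<omega>) j"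
  using compat unfolding noise_compatible_def by blast+

text \<open>\<open>E x(k) = B \<xi>(k)\<close> with \<open>\<xi>\<close> of dimension \<open>rank E\<close>, and \<open>\<xi>\<close> obeys an ordinary recursion.\<close>

primrec xi :: "real vec \<Rightarrow> nat \<Rightarrow> 'a \<Rightarrow> real vec" where
  "xi x\<^sub>0 0 \<omega> = K *\<^sub>v x\<^sub>0"
| "xi x\<^sub>0 (Suc k) \<omega> = H (r k \<omega>) *\<^sub>v xi x\<^sub>0 k \<omega> + w k \<omega> \<cdot>\<^sub>v (H' (r k \<omega>) *\<^sub>v xi x\<^sub>0 k \<omega>)"

text \<open>The mode at time \<open>k\<close> enters only here: \<open>xi\<close> at time
  \<open>k\<close> is built from earlier modes and earlier noise.\<close>

definition state :: "real vec \<Rightarrow> nat \<Rightarrow> 'a \<Rightarrow> real vec" where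
  "state x\<^sub>0 k \<omega> = G (r k \<omega>) *\<^sub>v xi x\<^sub>0 k \<omega>"

context
  fixes x\<^sub>0 :: "real vec"
  assumes x0: "x\<^sub>0 \<in> carrier_vec n"
begin

lemma xi_carrier: "\<omega> \<in> space M \<Longrightarrow> xi x\<^sub>0 k \<omega> \<in> carrier_vec d"
proof (induction k)
  case (Suc k)
  then show ?case
    using mult_mat_vec_carrier[OF carr_H[OF r_range]] mult_mat_vec_carrier[OF carr_H'[OF r_range]]
    by simp
qed (use carr_EBK x0 in simp)

lemma state_carrier: "\<omega> \<in> space M \<Longrightarrow> state x\<^sub>0 k \<omega> \<in> carrier_vec n"
  unfolding state_def by (rule mult_mat_vec_carrier[OF carr_G[OF r_range] xi_carrier])

lemma B_step:
  assumes \<omega>: "\<omega> \<in> space M"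
  shows "B *\<^sub>v xi x\<^sub>0 (Suc k) \<omega> =
    A (r k \<omega>) *\<^sub>v state x\<^sub>0 k \<omega> + w k \<omega> \<cdot>\<^sub>v (C (r k \<omega>) *\<^sub>v state x\<^sub>0 k \<omega>)"
proof -
  let ?i = "r k \<omega>" and ?x = "xi x\<^sub>0 k \<omega>"
  note i = r_range[OF \<omega>, of k] and x = xi_carrier[OF \<omega>, of k]
  have h: "H ?i *\<^sub>v ?x \<in> carrier_vec d" "H' ?i *\<^sub>v ?x \<in> carrier_vec d"
    using carr_H[OF i] carr_H'[OF i] x by auto
  have a: "A ?i *\<^sub>v state x\<^sub>0 k \<omega> = B *\<^sub>v (H ?i *\<^sub>v ?x)"
    using assoc_mult_mat_vec[OF carr_A[OF i] carr_G[OF i] x]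
      assoc_mult_mat_vec[OF carr_EBK(2) carr_H[OF i] x] AG[OF i] by (simp add: state_def)
  have c: "C ?i *\<^sub>v state x\<^sub>0 k \<omega> = B *\<^sub>v (H' ?i *\<^sub>v ?x)"
    using assoc_mult_mat_vec[OF carr_C[OF i] carr_G[OF i] x]
      assoc_mult_mat_vec[OF carr_EBK(2) carr_H'[OF i] x] CG[OF i] by (simp add: state_def)
  have "B *\<^sub>v (H ?i *\<^sub>v ?x + w k \<omega> \<cdot>\<^sub>v (H' ?i *\<^sub>v ?x)) =
      B *\<^sub>v (H ?i *\<^sub>v ?x) + B *\<^sub>v (w k \<omega> \<cdot>\<^sub>v (H' ?i *\<^sub>v ?x))"
    using h by (intro mult_add_distrib_mat_vec[OF carr_EBK(2)]) auto
  then show ?thesis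
    using a c mult_mat_vec[OF carr_EBK(2) h(2)] by simp
qed

lemma E_state:
  assumes \<omega>: "\<omega> \<in> space M"
  shows "E *\<^sub>v state x\<^sub>0 k \<omega> = B *\<^sub>v xi x\<^sub>0 k \<omega>"
proof -
  note i = r_range[OF \<omega>, of k] and x = xi_carrier[OF \<omega>, of k]
  have "E *\<^sub>v state x\<^sub>0 k \<omega> = B *\<^sub>v (K *\<^sub>v state x\<^sub>0 k \<omega>)"
    unfolding EBK by (rule assoc_mult_mat_vec[OF carr_EBK(2,3) state_carrier[OF \<omega>]])
  moreover have "K *\<^sub>v state x\<^sub>0 k \<omega> = xi x\<^sub>0 k \<omega>"
    using assoc_mult_mat_vec[OF carr_EBK(3) carr_G[OF i] x] KG[OF i] x by (simp add: state_def)
  ultimately show ?thesis by simp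
qed

lemma L2_mode_mult:
  assumes "L2_vec M (Hist k k) q z" "\<And>i. i \<in> {1..N} \<Longrightarrow> X i \<in> carrier_mat p q"
  shows "L2_vec M (Hist k k) p (\<lambda>\<omega>. X (r k \<omega>) *\<^sub>v z \<omega>)"
  by (rule L2_vec_mode_mult[OF sub_Hist assms(1) measurable_history_mode[OF order_refl] r_range _ assms(2)])
    auto

text \<open>The second form is the sharper one: the reduced state at time \<open>k+1\<close> is
  already known before the mode at time \<open>k+1\<close> is drawn. That allows this mode to be
  averaged out with the reduced state held fixed.\<close>

lemma L2_xi: "L2_vec M (Hist k k) d (xi x\<^sub>0 k)"
  and L2_xi_Suc: "L2_vec M (Hist k (Suc k)) d (xi x\<^sub>0 (Suc k))"
proof -
  have step: "L2_vec M (Hist k (Suc k)) d (xi x\<^sub>0 (Suc k))" if xi: "L2_vec M (Hist k k) d (xi x\<^sub>0 k)" for k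
  proof -
    interpret S: sigma_finite_subalgebra M "Hist k k"
      by (rule sigma_finite_Hist)
    have sub: "subalgebra (Hist k (Suc k)) (Hist k k)"
      by (rule subalgebra_history_mono) auto
    have "L2_vec M (Hist k (Suc k)) d (\<lambda>\<omega>. H (r k \<omega>) *\<^sub>v xi x\<^sub>0 k \<omega>)"
      by (rule L2_vec_mono[OF sub L2_mode_mult[OF xi carr_H]])
    moreover have "L2_vec M (Hist k (Suc k)) d (\<lambda>\<omega>. w k \<omega> \<cdot>\<^sub>v (H' (r k \<omega>) *\<^sub>v xi x\<^sub>0 k \<omega>))"
      by (rule S.L2_vec_noise_mult[OF sub_Hist sub measurable_history_noise noise_var
            L2_mode_mult[OF xi carr_H']]) auto
    ultimately have "L2_vec M (Hist k (Suc k)) d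
        (\<lambda>\<omega>. H (r k \<omega>) *\<^sub>v xi x\<^sub>0 k \<omega> + w k \<omega> \<cdot>\<^sub>v (H' (r k \<omega>) *\<^sub>v xi x\<^sub>0 k \<omega>))"
      by (rule L2_vec_add[OF sub_Hist])
    then show ?thesis
      by (simp only: xi.simps(2)[abs_def])
  qed
  have all: "L2_vec M (Hist k k) d (xi x\<^sub>0 k)" for k
  proof (induction k)
    case 0
    have "L2_vec M (Hist 0 0) d (\<lambda>_. K *\<^sub>v x\<^sub>0)"
      using carr_EBK x0 by (intro L2_vec_const finite_measure_axioms) simp
    then show ?case
      by (simp only: xi.simps(1)[abs_def])
  next
    case (Suc k)
    then show ?case
      by (intro L2_vec_mono[OF _ step] subalgebra_history_mono) auto
  qed
  then show "L2_vec M (Hist k k) d (xi x\<^sub>0 k)" "L2_vec M (Hist k (Suc k)) d (xi x\<^sub>0 (Suc k))"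
    using step by blast+
qed

lemma L2_state: "L2_vec M (Hist k k) n (state x\<^sub>0 k)"
  unfolding state_def[abs_def] by (rule L2_mode_mult[OF L2_xi carr_G])

lemma L2_drift: "L2_vec M (Hist k k) n (\<lambda>\<omega>. A (r k \<omega>) *\<^sub>v state x\<^sub>0 k \<omega>)"
  by (rule L2_mode_mult[OF L2_state carr_A])

lemma L2_diffusion: "L2_vec M (Hist k k) n (\<lambda>\<omega>. C (r k \<omega>) *\<^sub>v state x\<^sub>0 k \<omega>)"
  by (rule L2_mode_mult[OF L2_state carr_C])

text \<open>The condition modulo the kernel of \<open>E\<close> holds for every initial vector,
  since \<open>E x(0) = B K x\<^sub>0\<close>, which is written \<open>E = B * K\<close> applied to
  the initial vector. If that vector is consistent, the constraint at time 0 makes it equal to its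
  own lift by \<open>G\<close>.\<close>

lemma solution_state: "solution M n E A C r w x\<^sub>0 (state x\<^sub>0)"
  unfolding solution_def
proof (intro conjI allI ballI impI AE_I2)
  fix k j assume "j < n"
  then show "(\<lambda>\<omega>. state x\<^sub>0 k \<omega> $ j) \<in> borel_measurable M"
    using L2_state[of k] by (auto simp: L2_vec_def intro: measurable_from_subalg[OF sub_Hist])
next
  fix \<omega> assume \<omega>: "\<omega> \<in> space M"
  show "E *\<^sub>v state x\<^sub>0 0 \<omega> = E *\<^sub>v x\<^sub>0"
    unfolding E_state[OF \<omega>] using assoc_mult_mat_vec[OF carr_EBK(2,3) x0] by (simp add: EBK)
  assume "consistent_initial n E A C (r 0 \<omega>) (w 0 \<omega>) x\<^sub>0"
  then show "state x\<^sub>0 0 \<omega> = x\<^sub>0"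
    using consistent[OF r_range[OF \<omega>] x0] by (auto simp: consistent_initial_def state_def)
next
  fix \<omega> k assume \<omega>: "\<omega> \<in> space M"
  show "E *\<^sub>v state x\<^sub>0 (Suc k) \<omega> =
      A (r k \<omega>) *\<^sub>v state x\<^sub>0 k \<omega> + w k \<omega> \<cdot>\<^sub>v (C (r k \<omega>) *\<^sub>v state x\<^sub>0 k \<omega>)"
    unfolding E_state[OF \<omega>] by (rule B_step[OF \<omega>])
qed (rule state_carrier)

text \<open>Solvability of each equation forces \<open>y k\<close> into the range of
  \<open>G\<close> at the current mode, so \<open>K y\<close> determines \<open>y\<close>;
  injectivity of \<open>B\<close> then makes \<open>K y\<close> obey the recursion of
  \<open>xi\<close>. The argument is pathwise.\<close>

lemma solution_unique:
  assumes "solution M n E A C r w x\<^sub>0 y"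
  shows "AE \<omega> in M. \<forall>k. y k \<omega> = state x\<^sub>0 k \<omega>"
proof -
  have "AE \<omega> in M. E *\<^sub>v y 0 \<omega> = E *\<^sub>v x\<^sub>0"
    "AE \<omega> in M. \<forall>k. E *\<^sub>v y (Suc k) \<omega> = A (r k \<omega>) *\<^sub>v y k \<omega> + w k \<omega> \<cdot>\<^sub>v (C (r k \<omega>) *\<^sub>v y k \<omega>)"
    and yc: "\<And>k \<omega>. \<omega> \<in> space M \<Longrightarrow> y k \<omega> \<in> carrier_vec n"
    using assms by (auto simp: solution_def)
  from this(1,2) AE_space show ?thesis
  proof eventually_elim
    case (elim \<omega>)
    then have \<omega>: "\<omega> \<in> space M" by simp
    have Ey: "E *\<^sub>v v = B *\<^sub>v (K *\<^sub>v v)" if "v \<in> carrier_vec n" for v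
      unfolding EBK by (rule assoc_mult_mat_vec[OF carr_EBK(2,3) that])
    have Kc: "K *\<^sub>v v \<in> carrier_vec d" if "v \<in> carrier_vec n" for v
      using carr_EBK that by simp
    \<comment> \<open>The next state \<open>y (Suc k) \<omega>\<close> witnesses solvability at time
      \<open>k\<close>.\<close>
    have proj: "y k \<omega> = G (r k \<omega>) *\<^sub>v (K *\<^sub>v y k \<omega>)" for k
      using consistent[OF r_range[OF \<omega>] yc[OF \<omega>] yc[OF \<omega>]] elim(2) by blast
    have "K *\<^sub>v y k \<omega> = xi x\<^sub>0 k \<omega>" for k
    proof (induction k)
      case 0
      show ?case
        using injective_mat_cancel[OF injB carr_EBK(2) Kc Kc, OF yc[OF \<omega>] x0] elim(1)
          Ey[OF yc[OF \<omega>]] Ey[OF x0] by simp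
    next
      case (Suc k)
      then have yk: "y k \<omega> = state x\<^sub>0 k \<omega>"
        using proj[of k] by (simp add: state_def)
      have "B *\<^sub>v (K *\<^sub>v y (Suc k) \<omega>) = B *\<^sub>v xi x\<^sub>0 (Suc k) \<omega>"
        using elim(2) Ey[OF yc[OF \<omega>], of "Suc k"] yk B_step[OF \<omega>, of k] by metis
      then show ?case
        by (rule injective_mat_cancel[OF injB carr_EBK(2) Kc[OF yc[OF \<omega>]] xi_carrier[OF \<omega>]])
    qed
    then show ?case
      using proj by (simp add: state_def)
  qed
qed

text \<open>The expected Lyapunov function \<open>x(k)\<^sup>T E\<^sup>T P(r\<^sub>k) E x(k)\<close>.\<close>

definition energy :: "nat \<Rightarrow> real" where
  "energy k = (\<integral>\<omega>. (B *\<^sub>v xi x\<^sub>0 k \<omega>) \<bullet> (P (r k \<omega>) *\<^sub>v (B *\<^sub>v xi x\<^sub>0 k \<omega>)) \<partial>M)"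

lemma energy_nonneg: "0 \<le> energy k"
  unfolding energy_def
  by (intro Bochner_Integration.integral_nonneg_AE AE_I2 P_nonneg r_range
      mult_mat_vec_carrier[OF carr_EBK(2)] xi_carrier)

lemma L2_const_mult:
  assumes "L2_vec M (Hist k l) q z" "X \<in> carrier_mat p q"
  shows "L2_vec M (Hist k l) p (\<lambda>\<omega>. X *\<^sub>v z \<omega>)"
  using L2_vec_mode_mult[OF sub_Hist assms(1), of "\<lambda>_. 0" "{0}" "\<lambda>_. X" p] assms(2) by simp

text \<open>Two conditionings are nested. Given \<open>Hist k (Suc k)\<close>, the vector
  \<open>?z\<close> is known and the new mode is averaged, turning \<open>P\<close> into
  \<open>mode_average\<close>; given \<open>Hist k k\<close>, the noise \<open>w k\<close> is
  averaged, leaving the drift and diffusion contributions.\<close>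

lemma energy_Suc:
  "energy (Suc k) =
    (\<integral>\<omega>. (A (r k \<omega>) *\<^sub>v state x\<^sub>0 k \<omega>) \<bullet>
      (mode_average n N lam P (r k \<omega>) *\<^sub>v (A (r k \<omega>) *\<^sub>v state x\<^sub>0 k \<omega>)) \<partial>M) +
    (\<integral>\<omega>. (C (r k \<omega>) *\<^sub>v state x\<^sub>0 k \<omega>) \<bullet>
      (mode_average n N lam P (r k \<omega>) *\<^sub>v (C (r k \<omega>) *\<^sub>v state x\<^sub>0 k \<omega>)) \<partial>M)"
proof -
  let ?z = "\<lambda>\<omega>. B *\<^sub>v xi x\<^sub>0 (Suc k) \<omega>" and ?S = "mode_average n N lam P"
  let ?a = "\<lambda>\<omega>. A (r k \<omega>) *\<^sub>v state x\<^sub>0 k \<omega>" and ?c = "\<lambda>\<omega>. C (r k \<omega>) *\<^sub>v state x\<^sub>0 k \<omega>"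
  interpret S: sigma_finite_subalgebra M "Hist k k"
    by (rule sigma_finite_Hist)
  interpret S': sigma_finite_subalgebra M "Hist k (Suc k)"
    by (rule sigma_finite_Hist)
  have z: "L2_vec M (Hist k (Suc k)) n ?z"
    by (rule L2_const_mult[OF L2_xi_Suc carr_EBK(2)])
  have zc: "?z \<omega> \<in> carrier_vec n" if "\<omega> \<in> space M" for \<omega>
    using z that by (simp add: L2_vec_def)
  have q: "(\<lambda>\<omega>. ?z \<omega> \<bullet> (P j *\<^sub>v ?z \<omega>)) \<in> borel_measurable (Hist k (Suc k))"
    "integrable M (\<lambda>\<omega>. ?z \<omega> \<bullet> (P j *\<^sub>v ?z \<omega>))" if "j \<in> {1..N}" for j
    using L2_vec_scalar_prod[OF sub_Hist z L2_const_mult[OF z carr_P[OF that]]] by auto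
  have lam: "(\<lambda>\<omega>. lam (r k \<omega>) j) \<in> borel_measurable M" for j
    using measurable_compose[OF r_meas, of "\<lambda>i. lam i j" borel] by simp
  have "energy (Suc k) = (\<integral>\<omega>. (\<Sum>j\<in>{1..N}. lam (r k \<omega>) j * (?z \<omega> \<bullet> (P j *\<^sub>v ?z \<omega>))) \<partial>M)"
    unfolding energy_def
    by (rule S'.integral_mode_switch[OF r_meas r_range _ mode_law lam q]) auto
  also have "\<dots> = (\<integral>\<omega>. ?z \<omega> \<bullet> (?S (r k \<omega>) *\<^sub>v ?z \<omega>) \<partial>M)"
    using zc by (intro Bochner_Integration.integral_cong refl
        quadratic_form_mode_average[symmetric] carr_P) auto
  also have "\<dots> = (\<integral>\<omega>. (?a \<omega> + w k \<omega> \<cdot>\<^sub>v ?c \<omega>) \<bullet>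
      (?S (r k \<omega>) *\<^sub>v ?a \<omega> + w k \<omega> \<cdot>\<^sub>v (?S (r k \<omega>) *\<^sub>v ?c \<omega>)) \<partial>M)"
  proof (rule Bochner_Integration.integral_cong[OF refl])
    fix \<omega> assume \<omega>: "\<omega> \<in> space M"
    have a: "?a \<omega> \<in> carrier_vec n" and c: "?c \<omega> \<in> carrier_vec n"
      by (intro mult_mat_vec_carrier[OF carr_A[OF r_range[OF \<omega>]] state_carrier[OF \<omega>]]
          mult_mat_vec_carrier[OF carr_C[OF r_range[OF \<omega>]] state_carrier[OF \<omega>]])+
    have "?S (r k \<omega>) *\<^sub>v (?a \<omega> + w k \<omega> \<cdot>\<^sub>v ?c \<omega>) =
        ?S (r k \<omega>) *\<^sub>v ?a \<omega> + ?S (r k \<omega>) *\<^sub>v (w k \<omega> \<cdot>\<^sub>v ?c \<omega>)"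
      using a c by (intro mult_add_distrib_mat_vec[OF mode_average_carrier]) auto
    then show "?z \<omega> \<bullet> (?S (r k \<omega>) *\<^sub>v ?z \<omega>) = (?a \<omega> + w k \<omega> \<cdot>\<^sub>v ?c \<omega>) \<bullet>
        (?S (r k \<omega>) *\<^sub>v ?a \<omega> + w k \<omega> \<cdot>\<^sub>v (?S (r k \<omega>) *\<^sub>v ?c \<omega>))"
      unfolding B_step[OF \<omega>] using mult_mat_vec[OF mode_average_carrier c] by simp
  qed
  also have "\<dots> = (\<integral>\<omega>. ?a \<omega> \<bullet> (?S (r k \<omega>) *\<^sub>v ?a \<omega>) \<partial>M) +
      (\<integral>\<omega>. ?c \<omega> \<bullet> (?S (r k \<omega>) *\<^sub>v ?c \<omega>) \<partial>M)"
    by (rule S.integral_noise_scalar_prod[OF w_meas noise_mean noise_var L2_drift L2_diffusion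
          L2_mode_mult[OF L2_drift mode_average_carrier]
          L2_mode_mult[OF L2_diffusion mode_average_carrier]])
  finally show ?thesis .
qed

lemma energy_decay: "energy (Suc k) \<le> energy k - e * (\<integral>\<omega>. state x\<^sub>0 k \<omega> \<bullet> state x\<^sub>0 k \<omega> \<partial>M)"
proof -
  let ?S = "mode_average n N lam P"
  let ?a = "\<lambda>\<omega>. A (r k \<omega>) *\<^sub>v state x\<^sub>0 k \<omega>" and ?c = "\<lambda>\<omega>. C (r k \<omega>) *\<^sub>v state x\<^sub>0 k \<omega>"
  let ?z = "\<lambda>\<omega>. B *\<^sub>v xi x\<^sub>0 k \<omega>"
  note a = L2_drift[of k] and c = L2_diffusion[of k]
  have z: "L2_vec M (Hist k k) n ?z"
    by (rule L2_const_mult[OF L2_xi carr_EBK(2)])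
  have ia: "integrable M (\<lambda>\<omega>. ?a \<omega> \<bullet> (?S (r k \<omega>) *\<^sub>v ?a \<omega>))"
    by (rule L2_vec_scalar_prod(2)[OF sub_Hist a L2_mode_mult[OF a mode_average_carrier]])
  have ic: "integrable M (\<lambda>\<omega>. ?c \<omega> \<bullet> (?S (r k \<omega>) *\<^sub>v ?c \<omega>))"
    by (rule L2_vec_scalar_prod(2)[OF sub_Hist c L2_mode_mult[OF c mode_average_carrier]])
  have iz: "integrable M (\<lambda>\<omega>. ?z \<omega> \<bullet> (P (r k \<omega>) *\<^sub>v ?z \<omega>))"
    by (rule L2_vec_scalar_prod(2)[OF sub_Hist z L2_mode_mult[OF z carr_P]])
  have ix: "integrable M (\<lambda>\<omega>. e * (state x\<^sub>0 k \<omega> \<bullet> state x\<^sub>0 k \<omega>))"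
    using L2_vec_scalar_prod(2)[OF sub_Hist L2_state L2_state] by simp
  have "energy (Suc k) = (\<integral>\<omega>. ?a \<omega> \<bullet> (?S (r k \<omega>) *\<^sub>v ?a \<omega>) + ?c \<omega> \<bullet> (?S (r k \<omega>) *\<^sub>v ?c \<omega>) \<partial>M)"
    unfolding energy_Suc by (rule Bochner_Integration.integral_add[OF ia ic, symmetric])
  also have "\<dots> \<le> (\<integral>\<omega>. ?z \<omega> \<bullet> (P (r k \<omega>) *\<^sub>v ?z \<omega>) - e * (state x\<^sub>0 k \<omega> \<bullet> state x\<^sub>0 k \<omega>) \<partial>M)"
  proof (rule integral_mono)
    fix \<omega> assume \<omega>: "\<omega> \<in> space M"
    show "?a \<omega> \<bullet> (?S (r k \<omega>) *\<^sub>v ?a \<omega>) + ?c \<omega> \<bullet> (?S (r k \<omega>) *\<^sub>v ?c \<omega>) \<le>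
        ?z \<omega> \<bullet> (P (r k \<omega>) *\<^sub>v ?z \<omega>) - e * (state x\<^sub>0 k \<omega> \<bullet> state x\<^sub>0 k \<omega>)"
      by (rule decay[OF r_range[OF \<omega>] xi_carrier[OF \<omega>] state_def])
  qed (intro Bochner_Integration.integrable_add Bochner_Integration.integrable_diff ia ic iz ix)+
  also have "\<dots> = energy k - (\<integral>\<omega>. e * (state x\<^sub>0 k \<omega> \<bullet> state x\<^sub>0 k \<omega>) \<partial>M)"
    unfolding energy_def by (rule Bochner_Integration.integral_diff[OF iz ix])
  finally show ?thesis by simp
qed

text \<open>Telescoping \<open>energy_decay\<close> bounds \<open>e\<close> times each partial sum
  by the initial energy, because the energy never becomes negative.\<close>

lemma summable_second_moment: "summable (\<lambda>k. \<integral>\<omega>. state x\<^sub>0 k \<omega> \<bullet> state x\<^sub>0 k \<omega> \<partial>M)"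
proof (rule bounded_imp_summable)
  show "0 \<le> (\<integral>\<omega>. state x\<^sub>0 k \<omega> \<bullet> state x\<^sub>0 k \<omega> \<partial>M)" for k
    by (intro Bochner_Integration.integral_nonneg_AE AE_I2)
      (simp add: scalar_prod_self[OF state_carrier] sum_nonneg)
  have "e * (\<Sum>k\<le>m. \<integral>\<omega>. state x\<^sub>0 k \<omega> \<bullet> state x\<^sub>0 k \<omega> \<partial>M) \<le> energy 0 - energy (Suc m)" for m
  proof (induction m)
    case 0
    then show ?case using energy_decay[of 0] by simp
  next
    case (Suc m)
    then show ?case using energy_decay[of "Suc m"] by (simp add: distrib_left)
  qed
  then have "e * (\<Sum>k\<le>m. \<integral>\<omega>. state x\<^sub>0 k \<omega> \<bullet> state x\<^sub>0 k \<omega> \<partial>M) \<le> energy 0" for m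
    using energy_nonneg[of "Suc m"] by (smt (verit, best))
  then show "(\<Sum>k\<le>m. \<integral>\<omega>. state x\<^sub>0 k \<omega> \<bullet> state x\<^sub>0 k \<omega> \<partial>M) \<le> energy 0 / e" for m
    using e_pos by (simp add: pos_le_divide_eq mult.commute)
qed

lemma state_tendsto_0:
  "AE \<omega> in M. (\<lambda>k. nn_cond_exp M (Hist 0 0) (\<lambda>\<omega>. ennreal (state x\<^sub>0 k \<omega> \<bullet> state x\<^sub>0 k \<omega>)) \<omega>) \<longlonglongrightarrow> 0"
proof -
  interpret S: sigma_finite_subalgebra M "Hist 0 0"
    by (rule sigma_finite_Hist)
  show ?thesis
  proof (rule S.nn_cond_exp_tendsto_0[OF _ _ summable_second_moment])
    show "integrable M (\<lambda>\<omega>. state x\<^sub>0 k \<omega> \<bullet> state x\<^sub>0 k \<omega>)" for k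
      by (rule L2_vec_scalar_prod(2)[OF sub_Hist L2_state L2_state])
    show "0 \<le> state x\<^sub>0 k \<omega> \<bullet> state x\<^sub>0 k \<omega>" if "\<omega> \<in> space M" for k \<omega>
      by (simp add: scalar_prod_self[OF state_carrier[OF that]] sum_nonneg)
  qed
qed

end

section \<open>Existence, uniqueness and stability for the reduced system\<close>

lemma has_unique_solution: "has_unique_solution M n E A C r w"
  unfolding has_unique_solution_def
proof (intro ballI exI conjI allI impI)
  fix x\<^sub>0 :: "real vec" assume x0: "x\<^sub>0 \<in> carrier_vec n"
  show "solution M n E A C r w x\<^sub>0 (state x\<^sub>0)"
    by (rule solution_state[OF x0])
  show "(\<lambda>\<omega>. state x\<^sub>0 k \<omega> $ j) \<in> borel_measurable (Hist k k)" if "j < n" for k j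
    using L2_state[OF x0] that by (simp add: L2_vec_def)
  show "AE \<omega> in M. \<forall>k. y k \<omega> = state x\<^sub>0 k \<omega>" if "solution M n E A C r w x\<^sub>0 y" for y
    by (rule solution_unique[OF x0 that])
qed

lemma mean_square_stable: "mean_square_stable M n E A C r w"
  unfolding mean_square_stable_def
proof (intro conjI ballI allI impI has_unique_solution)
  fix x\<^sub>0 :: "real vec" and y
  assume x0: "x\<^sub>0 \<in> carrier_vec n" and y: "solution M n E A C r w x\<^sub>0 y"
  interpret S: sigma_finite_subalgebra M "Hist 0 0"
    by (rule sigma_finite_Hist)
  \<comment> \<open>Stability concerns every solution, not only \<open>state\<close>. Conditional
    expectations of almost everywhere equal functions agree once both functions are
    measurable.\<close>
  have meas: "(\<lambda>\<omega>. ennreal (v k \<omega> \<bullet> v k \<omega>)) \<in> borel_measurable M"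
    if "solution M n E A C r w x\<^sub>0 v" for v k
  proof -
    have v: "\<And>\<omega>. \<omega> \<in> space M \<Longrightarrow> v k \<omega> \<in> carrier_vec n"
      "\<And>j. j < n \<Longrightarrow> (\<lambda>\<omega>. v k \<omega> $ j) \<in> borel_measurable M"
      using that by (auto simp: solution_def)
    have "(\<lambda>\<omega>. ennreal (\<Sum>j<n. (v k \<omega> $ j)\<^sup>2)) \<in> borel_measurable M"
      using v(2) by (intro measurable_compose[OF _ measurable_ennreal] borel_measurable_sum
          borel_measurable_power) auto
    then show ?thesis
      using scalar_prod_self[OF v(1)]
      by (subst measurable_cong[of M _ "\<lambda>\<omega>. ennreal (\<Sum>j<n. (v k \<omega> $ j)\<^sup>2)"]) auto
  qed
  have "AE \<omega> in M. nn_cond_exp M (Hist 0 0) (\<lambda>\<omega>. ennreal (y k \<omega> \<bullet> y k \<omega>)) \<omega> =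
      nn_cond_exp M (Hist 0 0) (\<lambda>\<omega>. ennreal (state x\<^sub>0 k \<omega> \<bullet> state x\<^sub>0 k \<omega>)) \<omega>" for k
    using solution_unique[OF x0 y] by (intro S.nn_cond_exp_cong meas y solution_state x0) auto
  then have "AE \<omega> in M. \<forall>k. nn_cond_exp M (Hist 0 0) (\<lambda>\<omega>. ennreal (y k \<omega> \<bullet> y k \<omega>)) \<omega> =
      nn_cond_exp M (Hist 0 0) (\<lambda>\<omega>. ennreal (state x\<^sub>0 k \<omega> \<bullet> state x\<^sub>0 k \<omega>)) \<omega>"
    by (simp add: AE_all_countable)
  with state_tendsto_0[OF x0]
  show "AE \<omega> in M. (\<lambda>k. nn_cond_exp M (Hist 0 0) (\<lambda>\<omega>. ennreal (y k \<omega> \<bullet> y k \<omega>)) \<omega>) \<longlonglongrightarrow> 0"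
    by eventually_elim simp
qed

end

section \<open>From the matrix inequality to the reduced system\<close>

theorem theorem6:
  fixes M :: "'a measure" and n m N :: nat
    and E F Q :: "real mat" and A C P :: "nat \<Rightarrow> real mat"
    and lam :: "nat \<Rightarrow> nat \<Rightarrow> real"
    and r :: "nat \<Rightarrow> 'a \<Rightarrow> nat" and w :: "nat \<Rightarrow> 'a \<Rightarrow> real"
  assumes "prob_space M"
    and "markov_chain M N lam r"
    and "wide_sense_white_noise M w"
    and "noise_compatible M N lam r w"
    and "E \<in> carrier_mat n n"
    and "\<And>i. i \<in> {1..N} \<Longrightarrow> A i \<in> carrier_mat n n"
    and "\<And>i. i \<in> {1..N} \<Longrightarrow> C i \<in> carrier_mat n n"
    and "\<And>i. i \<in> {1..N} \<Longrightarrow>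
           vec_space.rank n (mat_of_cols n (cols E @ cols (C i))) = vec_space.rank n E"
    and "F \<in> carrier_mat n m" and "vec_space.rank n F = m"
    and "transpose_mat E * F = 0\<^sub>m n m"
    and "\<And>i. i \<in> {1..N} \<Longrightarrow> pos_def_mat n (P i)"
    and "nonsingular_mat m Q" and "transpose_mat Q = Q"
    and "\<And>i. i \<in> {1..N} \<Longrightarrow>
           neg_def_mat n
             (transpose_mat (A i) * (mode_average n N lam P i + F * Q * transpose_mat F) * A i
              + transpose_mat (C i) * (mode_average n N lam P i + F * Q * transpose_mat F) * C i
              - transpose_mat E * P i * E)"
  shows "mean_square_admissible M n N E A C r w"
proof -
  let ?S = "\<lambda>i. mode_average n N lam P i"
  let ?X = "\<lambda>i. transpose_mat (A i) * (?S i + F * Q * transpose_mat F) * A i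
              + transpose_mat (C i) * (?S i + F * Q * transpose_mat F) * C i
              - transpose_mat E * P i * E"
  note E = assms(5) and A = assms(6) and C = assms(7) and F = assms(9) and X = assms(15)
  have P: "P i \<in> carrier_mat n n" if "i \<in> {1..N}" for i
    using assms(12)[OF that] by (simp add: pos_def_mat_def)
  have Q: "Q \<in> carrier_mat m m"
    using assms(13) by (simp add: nonsingular_mat_def)
  have P_nonneg: "0 \<le> v \<bullet> (P i *\<^sub>v v)" if "i \<in> {1..N}" "v \<in> carrier_vec n" for i v
  proof (cases "v = 0\<^sub>v n")
    case True
    then show ?thesis using P[OF that(1)] by simp
  next
    case False
    then show ?thesis
      using assms(12)[OF that(1)] that(2) by (auto simp: pos_def_mat_def less_imp_le)
  qed
  have lam: "0 \<le> lam i j" if "i \<in> {1..N}" "j \<in> {1..N}" for i j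
    using assms(2) that unfolding markov_chain_def by blast
  have S_nonneg: "0 \<le> v \<bullet> (?S i *\<^sub>v v)" if "i \<in> {1..N}" "v \<in> carrier_vec n" for i v
  proof -
    have "v \<bullet> (?S i *\<^sub>v v) = (\<Sum>j=1..N. lam i j * (v \<bullet> (P j *\<^sub>v v)))"
      by (rule quadratic_form_mode_average) (use P that in auto)
    also have "\<dots> \<ge> 0"
      using lam[OF that(1)] P_nonneg[OF _ that(2)] by (intro sum_nonneg mult_nonneg_nonneg)
    finally show ?thesis .
  qed
  define d where "d = vec_space.rank n E"
  obtain B K where B: "B \<in> carrier_mat n d" and K: "K \<in> carrier_mat d n"
    and injB: "injective_mat B" and colsB: "set (cols B) \<subseteq> set (cols E)" and EBK: "E = B * K"
    using rank_factorization[OF E] unfolding d_def by metis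
  have injF: "injective_mat F"
    by (rule injective_mat_if_full_rank[OF F assms(10)])
  have FB: "transpose_mat F * B = 0\<^sub>m m d"
    by (rule annihilator_range_basis[OF E F assms(11) B colsB])
  have Ft: "transpose_mat F \<in> carrier_mat m n"
    using F by simp
  have FBv: "transpose_mat F *\<^sub>v (B *\<^sub>v v) = 0\<^sub>v m" if "v \<in> carrier_vec d" for v
    using assoc_mult_mat_vec[OF Ft B that] FB that by simp
  have "\<exists>KC \<in> carrier_mat d n. C i = B * KC" if "i \<in> {1..N}" for i
    using factor_through_rank_condition[OF E C[OF that] _ B injB colsB] assms(8)[OF that]
    unfolding d_def by metis
  then obtain KC where KC: "\<And>i. i \<in> {1..N} \<Longrightarrow> KC i \<in> carrier_mat d n"
    and CBK: "\<And>i. i \<in> {1..N} \<Longrightarrow> C i = B * KC i"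
    by metis
  have FC: "transpose_mat F *\<^sub>v (C i *\<^sub>v x) = 0\<^sub>v m" if "i \<in> {1..N}" "x \<in> carrier_vec n" for i x
    using FBv[of "KC i *\<^sub>v x"] assoc_mult_mat_vec[OF B KC[OF that(1)] that(2)] CBK[OF that(1)]
      mult_mat_vec_carrier[OF KC[OF that(1)] that(2)] by simp
  have form: "x \<bullet> (?X i *\<^sub>v x) = (A i *\<^sub>v x) \<bullet> (?S i *\<^sub>v (A i *\<^sub>v x)) +
      (C i *\<^sub>v x) \<bullet> (?S i *\<^sub>v (C i *\<^sub>v x)) - (E *\<^sub>v x) \<bullet> (P i *\<^sub>v (E *\<^sub>v x))"
    if "i \<in> {1..N}" "x \<in> carrier_vec n" "transpose_mat F *\<^sub>v (A i *\<^sub>v x) = 0\<^sub>v m" for i x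
    by (rule lyapunov_form[OF mode_average_carrier F Q A C E P]) (use that FC in auto)
  \<comment> \<open>Only positivity of the form survives on the kernel of \<open>E\<close>; this also forces \<open>m = n - rank E\<close>.\<close>
  have ker: "x = 0\<^sub>v n" if i: "i \<in> {1..N}" and x: "x \<in> carrier_vec n"
    and "E *\<^sub>v x = 0\<^sub>v n" "transpose_mat F *\<^sub>v (A i *\<^sub>v x) = 0\<^sub>v m" for i x
  proof (rule ccontr)
    assume "x \<noteq> 0\<^sub>v n"
    then have "x \<bullet> (?X i *\<^sub>v x) < 0"
      using X[OF i] x by (simp add: neg_def_mat_def)
    moreover have "0 \<le> x \<bullet> (?X i *\<^sub>v x)"
      unfolding form[OF i x that(4)] that(3)
      using S_nonneg[OF i mult_mat_vec_carrier[OF A[OF i] x]]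
        S_nonneg[OF i mult_mat_vec_carrier[OF C[OF i] x]] P[OF i] by simp
    ultimately show False by simp
  qed
  \<comment> \<open>All data of one mode are gathered under one existential, so that choice yields
    \<open>G\<close>, \<open>H\<close> and \<open>H'\<close> as functions of the mode.\<close>
  have "\<exists>G H H'. causal_b n E (A i) (C i) \<and>
      G \<in> carrier_mat n d \<and> H \<in> carrier_mat d d \<and> H' \<in> carrier_mat d d \<and>
      K * G = 1\<^sub>m d \<and> A i * G = B * H \<and> C i * G = B * H' \<and>
      (\<forall>x y u. x \<in> carrier_vec n \<longrightarrow> y \<in> carrier_vec n \<longrightarrow>
        E *\<^sub>v y = A i *\<^sub>v x + u \<cdot>\<^sub>v (C i *\<^sub>v x) \<longrightarrow> x = G *\<^sub>v (K *\<^sub>v x))"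
    if i: "i \<in> {1..N}" for i
    using causal_reduction[OF E A[OF i] C[OF i] F injF d_def B K KC[OF i] injB EBK CBK[OF i] FB]
      ker[OF i] by metis
  then obtain G H H' where red: "\<And>i. i \<in> {1..N} \<Longrightarrow> causal_b n E (A i) (C i) \<and>
      G i \<in> carrier_mat n d \<and> H i \<in> carrier_mat d d \<and> H' i \<in> carrier_mat d d \<and>
      K * G i = 1\<^sub>m d \<and> A i * G i = B * H i \<and> C i * G i = B * H' i \<and>
      (\<forall>x y u. x \<in> carrier_vec n \<longrightarrow> y \<in> carrier_vec n \<longrightarrow>
        E *\<^sub>v y = A i *\<^sub>v x + u \<cdot>\<^sub>v (C i *\<^sub>v x) \<longrightarrow> x = G i *\<^sub>v (K *\<^sub>v x))"
    by metis
  have "\<exists>e>0. \<forall>x\<in>carrier_vec n. x \<bullet> (?X i *\<^sub>v x) \<le> - e * (x \<bullet> x)" if "i \<in> {1..N}" for i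
    using neg_def_mat_bound[OF X[OF that]] by metis
  then obtain f where f: "\<And>i. i \<in> {1..N} \<Longrightarrow> f i > 0"
    "\<And>i x. i \<in> {1..N} \<Longrightarrow> x \<in> carrier_vec n \<Longrightarrow> x \<bullet> (?X i *\<^sub>v x) \<le> - f i * (x \<bullet> x)"
    by metis
  \<comment> \<open>One rate for all modes; the inserted 1 keeps the set nonempty.\<close>
  define e where "e = Min (insert 1 (f ` {1..N}))"
  have e: "0 < e" "\<And>i. i \<in> {1..N} \<Longrightarrow> e \<le> f i"
    unfolding e_def using f(1) by (auto simp del: Min_insert intro!: Min_le)
  interpret reduced_jump_system M n d N lam r w E B K A C P G H H' e
  proof (intro reduced_jump_system.intro reduced_jump_system_axioms.intro)
    fix i v x
    assume i: "i \<in> {1..N}" and v: "v \<in> carrier_vec d" and x: "x = G i *\<^sub>v v"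
    have xc: "x \<in> carrier_vec n"
      using red[OF i] v x by (metis mult_mat_vec_carrier)
    \<comment> \<open>Being in the range of \<open>B\<close>, this vector is killed by
      \<open>F^T\<close>, so the form of the inequality at \<open>x\<close> reduces to terms free of
      \<open>Q\<close>.\<close>
    have "A i *\<^sub>v x = B *\<^sub>v (H i *\<^sub>v v)"
      using red[OF i] v x assoc_mult_mat_vec[OF A[OF i] _ v] assoc_mult_mat_vec[OF B _ v] by metis
    then have FA: "transpose_mat F *\<^sub>v (A i *\<^sub>v x) = 0\<^sub>v m"
      using FBv red[OF i] v by (metis mult_mat_vec_carrier)
    have "K *\<^sub>v x = v"
      using red[OF i] v x assoc_mult_mat_vec[OF K _ v] by (metis one_mult_mat_vec)
    then have Ex: "E *\<^sub>v x = B *\<^sub>v v"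
      unfolding EBK using assoc_mult_mat_vec[OF B K xc] by simp
    have "0 \<le> x \<bullet> x"
      by (simp add: scalar_prod_self[OF xc] sum_nonneg)
    then have "x \<bullet> (?X i *\<^sub>v x) \<le> - e * (x \<bullet> x)"
      using f(2)[OF i xc] mult_right_mono[OF e(2)[OF i], of "x \<bullet> x"] by linarith
    then show "(A i *\<^sub>v x) \<bullet> (?S i *\<^sub>v (A i *\<^sub>v x)) + (C i *\<^sub>v x) \<bullet> (?S i *\<^sub>v (C i *\<^sub>v x)) \<le>
        (B *\<^sub>v v) \<bullet> (P i *\<^sub>v (B *\<^sub>v v)) - e * (x \<bullet> x)"
      unfolding form[OF i xc FA] Ex by linarith
  next
    fix i x y u
    assume "i \<in> {1..N}" "x \<in> carrier_vec n" "y \<in> carrier_vec n"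
      "E *\<^sub>v y = A i *\<^sub>v x + u \<cdot>\<^sub>v (C i *\<^sub>v x)"
    then show "x = G i *\<^sub>v (K *\<^sub>v x)"
      using red by blast
  qed (fact assms(1-4) E B K A C P P_nonneg EBK injB e(1) | simp add: red)+
  have "causal n N E A C"
    using red by (auto simp: causal_def)
  then show ?thesis
    using has_unique_solution mean_square_stable by (simp add: mean_square_admissible_def)
qed

end
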